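(* The Kähler metric $g_{\mathcal{T}_{S^2}}$ on the tangent manifold $\mathcal{T}_{S^2}$ of the round 2-sphere coincides with the Eguchi-Hanson or Stenzel metric on $\mathcal{T}_{S^2}$.
   Context: Let $\pi:\mathcal{T}_{S^2}\to S^2$ be the total space of the tangent bundle of the 2-sphere with its metric $g_{S^2}$ of constant sectional curvature $K>0$, and let $r=r(u)=\|u\|$ for $u\in\mathcal{T}_{S^2}$. The Levi-Civita connection of $g_{S^2}$ induces a splitting $T\mathcal{T}_{S^2}=H\oplus V$ into horizontal and vertical ($V=\ker\mathrm{d}\pi$) sub-bundles, each canonically isomorphic to $\pi^*TS^2$; let $w^h,w^v$ denote the horizontal and vertical lifts of $w$. Then $\pi^*g_{S^2}$ is the symmetric 2-tensor with $\pi^*g_{S^2}(w^h,z^h)=g_{S^2}(w,z)$, vanishing when one argument is vertical, and $\pi^\star g_{S^2}$ the symmetric 2-tensor with $\pi^\star g_{S^2}(w^v,z^v)=g_{S^2}(w,z)$, vanishing when one argument is horizontal. With a constant $c_1>0$, the metric is $$g_{\mathcal{T}_{S^2}}=\sqrt{c_1+Kr^2}\;\pi^*g_{S^2}+\frac{1}{\sqrt{c_1+Kr^2}}\;\pi^\star g_{S^2},$$ which is Kähler for the complex structure $J(w^h)=\sqrt{c_1+Kr^2}\,w^v$, $J(w^v)=-\frac{1}{\sqrt{c_1+Kr^2}}\,w^h$. The constants may be normalised; the comparison is made with $K=1$, $c_1=1$. The Stenzel metric on $\mathcal{T}_{S^2}$, which in this dimension is the Eguchi-Hanson metric, is the well-known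 Ricci-flat Kähler metric which, away from the zero section, identifying $\mathcal{T}_{S^2}\setminus0$ with $\mathrm{SO}(3)\times(0,+\infty)$ (the unit tangent bundle of $S^2$ times the radial variable) and writing $r=\sinh\tau$, has the form $$\cosh\tau\,(\alpha_0^2+\alpha_1^2)+\cosh\tau\,(\mathrm{d}\tau)^2+\sinh\tau\tanh\tau\,\alpha_2^2 .$$ Here $\alpha_0,\alpha_1,\alpha_2$ is the canonical coframe on the unit tangent bundle of $S^2$: at a unit vector $u$, with $u^\perp$ the unit tangent vector completing $u$ to an oriented orthonormal basis, $\alpha_0,\alpha_1$ vanish on vertical vectors and $\alpha_0(w^h)=g_{S^2}(w,u)$, $\alpha_1(w^h)=g_{S^2}(w,u^\perp)$, while $\alpha_2$ vanishes on horizontal vectors and $\alpha_2(w^v)=g_{S^2}(w,u^\perp)$. *)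

theory Defs
  imports "HOL-Analysis.Analysis"
begin

section \<open>Calculus on embedded submanifolds of Euclidean spaces\<close>

text \<open>
  All manifolds below are embedded submanifolds \<open>M\<close> of a Euclidean space. Fields and tensors on
  \<open>M\<close> are total functions on the ambient space; only their values at points of \<open>M\<close>
  (and, for tensors, on vectors tangent to \<open>M\<close>) matter.
\<close>

text \<open>Class \<open>C\<^sup>k\<close> on an open set \<open>U\<close>.\<close>

primrec Ck_on :: "nat \<Rightarrow> 'a::euclidean_space set \<Rightarrow> ('a \<Rightarrow> 'b::real_normed_vector) \<Rightarrow> bool" where
  "Ck_on 0 U f = continuous_on U f"
| "Ck_on (Suc k) U f =
     ((\<forall>x\<in>U. f differentiable (at x)) \<and> (\<forall>v. Ck_on k U (\<lambda>x. frechet_derivative f (at x) v)))"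

definition smooth_on :: "'a::euclidean_space set \<Rightarrow> ('a \<Rightarrow> 'b::real_normed_vector) \<Rightarrow> bool" where
  "smooth_on A f \<longleftrightarrow>
     (\<exists>U F. open U \<and> A \<subseteq> U \<and> (\<forall>k. Ck_on k U F) \<and> (\<forall>x\<in>A. f x = F x))"

definition tangent_space :: "'a::euclidean_space set \<Rightarrow> 'a \<Rightarrow> 'a set" where
  "tangent_space M p =
     {d. \<exists>\<epsilon>>0. \<exists>c::real \<Rightarrow> 'a. smooth_on {-\<epsilon><..<\<epsilon>} c \<and> (\<forall>t\<in>{-\<epsilon><..<\<epsilon>}. c t \<in> M) \<and>
            c 0 = p \<and> (c has_vector_derivative d) (at 0)}"

definition tangent_bundle :: "'a::euclidean_space set \<Rightarrow> ('a \<times> 'a) set" where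
  "tangent_bundle M = {(x, v). x \<in> M \<and> v \<in> tangent_space M x}"

definition vector_field :: "'a::euclidean_space set \<Rightarrow> ('a \<Rightarrow> 'a) \<Rightarrow> bool" where
  "vector_field M X \<longleftrightarrow> smooth_on M X \<and> (\<forall>p\<in>M. X p \<in> tangent_space M p)"

text \<open>
  Derivative of \<open>f\<close>, defined on \<open>M\<close>, in the tangent direction \<open>w\<close>. A derivative within
  \<open>M\<close> is not unique as a linear map on the ambient space, but its values on vectors tangent to
  \<open>M\<close> are.
\<close>

definition tderiv :: "'a::euclidean_space set \<Rightarrow> ('a \<Rightarrow> 'b::real_normed_vector) \<Rightarrow> 'a \<Rightarrow> 'a \<Rightarrow> 'b" where
  "tderiv M f p w = frechet_derivative f (at p within M) w"

definition lie_bracket :: "'a::euclidean_space set \<Rightarrow> ('a \<Rightarrow> 'a) \<Rightarrow> ('a \<Rightarrow> 'a) \<Rightarrow> 'a \<Rightarrow> 'a" where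
  "lie_bracket M X Y p = tderiv M Y p (X p) - tderiv M X p (Y p)"

definition riemannian_metric :: "'a::euclidean_space set \<Rightarrow> ('a \<Rightarrow> 'a \<Rightarrow> 'a \<Rightarrow> real) \<Rightarrow> bool" where
  "riemannian_metric M g \<longleftrightarrow>
     (\<forall>p\<in>M. \<forall>v\<in>tangent_space M p. \<forall>w\<in>tangent_space M p. g p v w = g p w v) \<and>
     (\<forall>p\<in>M. \<forall>v\<in>tangent_space M p. \<forall>v'\<in>tangent_space M p. \<forall>w\<in>tangent_space M p. \<forall>a.
        g p (a *\<^sub>R v + v') w = a * g p v w + g p v' w) \<and>
     (\<forall>p\<in>M. \<forall>v\<in>tangent_space M p. v \<noteq> 0 \<longrightarrow> g p v v > 0) \<and>
     (\<forall>X Y. vector_field M X \<and> vector_field M Y \<longrightarrow> smooth_on M (\<lambda>p. g p (X p) (Y p)))"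

definition affine_connection ::
    "'a::euclidean_space set \<Rightarrow> (('a \<Rightarrow> 'a) \<Rightarrow> ('a \<Rightarrow> 'a) \<Rightarrow> 'a \<Rightarrow> 'a) \<Rightarrow> bool" where
  "affine_connection M nabla \<longleftrightarrow>
     (\<forall>X Y. vector_field M X \<and> vector_field M Y \<longrightarrow> vector_field M (nabla X Y)) \<and>
     (\<forall>X X' Y. \<forall>f::'a \<Rightarrow> real. \<forall>p\<in>M.
        vector_field M X \<and> vector_field M X' \<and> vector_field M Y \<and> smooth_on M f \<longrightarrow>
        nabla (\<lambda>q. f q *\<^sub>R X q + X' q) Y p = f p *\<^sub>R nabla X Y p + nabla X' Y p) \<and>
     (\<forall>X Y Z. \<forall>f::'a \<Rightarrow> real. \<forall>p\<in>M.
        vector_field M X \<and> vector_field M Y \<and> vector_field M Z \<and> smooth_on M f \<longrightarrow>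
        nabla X (\<lambda>q. f q *\<^sub>R Y q + Z q) p =
          f p *\<^sub>R nabla X Y p + tderiv M f p (X p) *\<^sub>R Y p + nabla X Z p)"

definition is_levi_civita ::
    "'a::euclidean_space set \<Rightarrow> ('a \<Rightarrow> 'a \<Rightarrow> 'a \<Rightarrow> real) \<Rightarrow> (('a \<Rightarrow> 'a) \<Rightarrow> ('a \<Rightarrow> 'a) \<Rightarrow> 'a \<Rightarrow> 'a) \<Rightarrow> bool" where
  "is_levi_civita M g nabla \<longleftrightarrow>
     affine_connection M nabla \<and>
     (\<forall>X Y. \<forall>p\<in>M. vector_field M X \<and> vector_field M Y \<longrightarrow>
        nabla X Y p - nabla Y X p = lie_bracket M X Y p) \<and>
     (\<forall>X Y Z. \<forall>p\<in>M. vector_field M X \<and> vector_field M Y \<and> vector_field M Z \<longrightarrow>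
        tderiv M (\<lambda>q. g q (Y q) (Z q)) p (X p) = g p (nabla X Y p) (Z p) + g p (Y p) (nabla X Z p))"

text \<open>The choice is immaterial: two Levi-Civita connections agree on vector fields at points of \<open>M\<close>.\<close>

definition levi_civita ::
    "'a::euclidean_space set \<Rightarrow> ('a \<Rightarrow> 'a \<Rightarrow> 'a \<Rightarrow> real) \<Rightarrow> ('a \<Rightarrow> 'a) \<Rightarrow> ('a \<Rightarrow> 'a) \<Rightarrow> 'a \<Rightarrow> 'a" where
  "levi_civita M g = (SOME nabla. is_levi_civita M g nabla)"


section \<open>The round sphere, its tangent bundle and the splitting\<close>

type_synonym R3 = "real ^ 3"
type_synonym TR3 = "(real ^ 3) \<times> (real ^ 3)"

text \<open>The round 2-sphere of curvature \<open>K\<close> is the sphere of radius \<open>1 / sqrt K\<close> in Euclidean 3-space.\<close>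

definition S2 :: "real \<Rightarrow> R3 set" where
  "S2 K = sphere 0 (1 / sqrt K)"

definition g_S2 :: "R3 \<Rightarrow> R3 \<Rightarrow> R3 \<Rightarrow> real" where
  "g_S2 x w z = w \<bullet> z"

definition TS2 :: "real \<Rightarrow> TR3 set" where
  "TS2 K = tangent_bundle (S2 K)"

text \<open>
  A point of \<open>TS2 K\<close> is \<open>u = (x, v)\<close> with projection \<open>fst u\<close>, so that the differential
  of the projection is \<open>fst\<close> on tangent vectors of \<open>TS2 K\<close>. The horizontal space at
  \<open>u\<close> consists of the images of tangent vectors \<open>X x\<close> under the differentials of the
  sections \<open>\<lambda>y. (y, Y y)\<close> with \<open>Y x = v\<close> that are parallel at \<open>x\<close> in direction
  \<open>X x\<close>.
\<close>

definition horizontal_space :: "real \<Rightarrow> TR3 \<Rightarrow> TR3 set" where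
  "horizontal_space K u =
     {(X (fst u), tderiv (S2 K) Y (fst u) (X (fst u))) | X Y.
        vector_field (S2 K) X \<and> vector_field (S2 K) Y \<and> Y (fst u) = snd u \<and>
        levi_civita (S2 K) g_S2 X Y (fst u) = 0}"

definition hlift :: "real \<Rightarrow> TR3 \<Rightarrow> R3 \<Rightarrow> TR3" where
  "hlift K u w = (THE \<xi>. \<xi> \<in> horizontal_space K u \<and> fst \<xi> = w)"

text \<open>The vertical lift is the velocity at \<open>t = 0\<close> of \<open>t \<mapsto> (x, v + t w)\<close>.\<close>

definition vlift :: "TR3 \<Rightarrow> R3 \<Rightarrow> TR3" where
  "vlift u w = (0, w)"

text \<open>The unique \<open>(w, z)\<close> such that \<open>\<xi>\<close> is the sum of the horizontal lift of \<open>w\<close> and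
  the vertical lift of \<open>z\<close>.\<close>

definition components :: "real \<Rightarrow> TR3 \<Rightarrow> TR3 \<Rightarrow> R3 \<times> R3" where
  "components K u \<xi> =
     (THE (w, z). w \<in> tangent_space (S2 K) (fst u) \<and> z \<in> tangent_space (S2 K) (fst u) \<and>
        \<xi> = hlift K u w + vlift u z)"

definition hcomp :: "real \<Rightarrow> TR3 \<Rightarrow> TR3 \<Rightarrow> R3" where
  "hcomp K u \<xi> = fst (components K u \<xi>)"

definition vcomp :: "real \<Rightarrow> TR3 \<Rightarrow> TR3 \<Rightarrow> R3" where
  "vcomp K u \<xi> = snd (components K u \<xi>)"


section \<open>The metric on the tangent bundle\<close>

definition pi_pullback_hor :: "real \<Rightarrow> TR3 \<Rightarrow> TR3 \<Rightarrow> TR3 \<Rightarrow> real" where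
  "pi_pullback_hor K u \<xi> \<eta> = g_S2 (fst u) (hcomp K u \<xi>) (hcomp K u \<eta>)"

definition pi_pullback_ver :: "real \<Rightarrow> TR3 \<Rightarrow> TR3 \<Rightarrow> TR3 \<Rightarrow> real" where
  "pi_pullback_ver K u \<xi> \<eta> = g_S2 (fst u) (vcomp K u \<xi>) (vcomp K u \<eta>)"

definition fibre_norm :: "TR3 \<Rightarrow> real" where
  "fibre_norm u = sqrt (g_S2 (fst u) (snd u) (snd u))"

definition g_TS2 :: "real \<Rightarrow> real \<Rightarrow> TR3 \<Rightarrow> TR3 \<Rightarrow> TR3 \<Rightarrow> real" where
  "g_TS2 K c\<^sub>1 u \<xi> \<eta> =
     sqrt (c\<^sub>1 + K * (fibre_norm u)\<^sup>2) * pi_pullback_hor K u \<xi> \<eta> +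
     1 / sqrt (c\<^sub>1 + K * (fibre_norm u)\<^sup>2) * pi_pullback_ver K u \<xi> \<eta>"


section \<open>The Stenzel (Eguchi-Hanson) metric\<close>

definition unit_tangent_bundle :: "TR3 set" where
  "unit_tangent_bundle = {u \<in> TS2 1. fibre_norm u = 1}"

text \<open>
  For a unit tangent vector \<open>u = (x, e)\<close> of the unit sphere, \<open>perp u\<close> completes \<open>e\<close> to an
  oriented orthonormal basis of the tangent plane at \<open>x\<close>, oriented by the outward normal
  \<open>x\<close>; \<open>(x, e, perp u)\<close> is then the corresponding frame in \<open>SO(3)\<close>.
\<close>

definition perp :: "TR3 \<Rightarrow> R3" where
  "perp u = cross3 (fst u) (snd u)"

definition alpha0 :: "TR3 \<Rightarrow> TR3 \<Rightarrow> real" where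
  "alpha0 u \<xi> = g_S2 (fst u) (hcomp 1 u \<xi>) (snd u)"

definition alpha1 :: "TR3 \<Rightarrow> TR3 \<Rightarrow> real" where
  "alpha1 u \<xi> = g_S2 (fst u) (hcomp 1 u \<xi>) (perp u)"

definition alpha2 :: "TR3 \<Rightarrow> TR3 \<Rightarrow> real" where
  "alpha2 u \<xi> = g_S2 (fst u) (vcomp 1 u \<xi>) (perp u)"

text \<open>The manifold \<open>SO(3) \<times> (0, \<infinity>)\<close>, with points \<open>(u, \<tau>)\<close>, and its identification
  with the complement of the zero section, with \<open>r = sinh \<tau>\<close>.\<close>

definition polar_domain :: "(TR3 \<times> real) set" where
  "polar_domain = unit_tangent_bundle \<times> {0<..}"

definition polar :: "TR3 \<times> real \<Rightarrow> TR3" where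
  "polar p = (fst (fst p), sinh (snd p) *\<^sub>R snd (fst p))"

definition stenzel_form :: "TR3 \<times> real \<Rightarrow> TR3 \<times> real \<Rightarrow> TR3 \<times> real \<Rightarrow> real" where
  "stenzel_form p \<zeta> \<eta> = (let u = fst p; \<tau> = snd p in
     cosh \<tau> * (alpha0 u (fst \<zeta>) * alpha0 u (fst \<eta>) + alpha1 u (fst \<zeta>) * alpha1 u (fst \<eta>)) +
     cosh \<tau> * (snd \<zeta> * snd \<eta>) +
     sinh \<tau> * tanh \<tau> * (alpha2 u (fst \<zeta>) * alpha2 u (fst \<eta>)))"

text \<open>A Riemannian metric on the whole of \<open>TS2 1\<close>, zero section included, whose pullback
  along \<open>polar\<close> is the Stenzel form.\<close>

definition is_stenzel_metric :: "(TR3 \<Rightarrow> TR3 \<Rightarrow> TR3 \<Rightarrow> real) \<Rightarrow> bool" where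
  "is_stenzel_metric s \<longleftrightarrow>
     riemannian_metric (TS2 1) s \<and>
     (\<forall>p\<in>polar_domain. \<forall>\<zeta>\<in>tangent_space polar_domain p. \<forall>\<eta>\<in>tangent_space polar_domain p.
        s (polar p) (tderiv polar_domain polar p \<zeta>) (tderiv polar_domain polar p \<eta>) =
        stenzel_form p \<zeta> \<eta>)"

end

theory Submission
  imports Defs
begin

text \<open>
  The Levi-Civita connection of the unit sphere is the tangential part of the ambient derivative, so
  at \<open>(x, v)\<close> the vector \<open>(a, b)\<close> has horizontal part \<open>a\<close> and vertical
  part \<open>b + (a \<bullet> v) x\<close>. In the coordinates \<open>v = sinh \<tau> e\<close> the weight
  \<open>sqrt (1 + r\<^sup>2)\<close> is \<open>cosh \<tau>\<close>, and expanding in the orthonormal frame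
  \<open>e, x \<times> e\<close> gives the Stenzel form. The polar map is a surjective submersion onto the
  complement of the zero section, which determines the metric there; on the zero section it is
  determined by continuity.
\<close>

section \<open>Smooth functions\<close>

text \<open>The obstacle is that \<open>tderiv\<close>, \<open>levi_civita\<close>,
  \<open>hlift\<close> and \<open>components\<close> are defined by choice or description operators,
  so each has to be pinned to an explicit formula before anything can be computed. A derivative
  within \<open>M\<close> is determined only on velocities of curves in \<open>M\<close>; hence the
  tangent spaces of the sphere, of its tangent bundle and of the polar domain are needed exactly,
  not just up to inclusion. Their equations come from differentiating the constraints, and the
  curves that realise them are straight lines corrected by normalisation and projection. The
  correction costs nothing to first order precisely because of those equations.

  The continuity used on the zero section is not directly available either: a Riemannian metric is
  smooth here only when evaluated on smooth vector fields, so individual tangent vectors have to be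
  extended to fields on the whole bundle.\<close>

lemma Ck_on_subset: "Ck_on k U f \<Longrightarrow> V \<subseteq> U \<Longrightarrow> Ck_on k V f"
  by (induction k arbitrary: f) (auto intro: continuous_on_subset)

lemma Ck_on_SucD:
  assumes "Ck_on (Suc k) U f" "x \<in> U"
  shows "(f has_derivative frechet_derivative f (at x)) (at x)"
  using assms by (simp add: frechet_derivative_works)

lemma Ck_on_imp_continuous_on: "Ck_on k U f \<Longrightarrow> continuous_on U f"
  by (cases k)
    (auto intro!: continuous_at_imp_continuous_on differentiable_imp_continuous_within)

lemma Ck_on_lower: "Ck_on (Suc k) U f \<Longrightarrow> Ck_on k U f"
proof (induction k arbitrary: f)
  case 0
  then show ?case by (metis Ck_on.simps(1) Ck_on_imp_continuous_on)
next
  case (Suc k)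
  then show ?case by (metis Ck_on.simps(2))
qed

text \<open>\<open>frechet_derivative f (at x)\<close> depends only on \<open>f\<close> near
  \<open>x\<close>, so on an open set equality of functions passes to all iterated
  derivatives.\<close>

lemma Ck_on_cong:
  assumes "open U" "Ck_on k U f" "\<And>x. x \<in> U \<Longrightarrow> f x = g x"
  shows "Ck_on k U g"
  using assms(2,3)
proof (induction k arbitrary: f g)
  case 0
  then show ?case by (simp cong: continuous_on_cong)
next
  case (Suc k)
  have d: "(g has_derivative frechet_derivative f (at x)) (at x)" if "x \<in> U" for x
    using has_derivative_transform_within_open[OF Ck_on_SucD[OF Suc.prems(1) that] assms(1) that]
      Suc.prems(2) by blast
  have eq: "frechet_derivative f (at x) v = frechet_derivative g (at x) v" if "x \<in> U" for x v
    using frechet_derivative_at[OF d[OF that]] by simp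
  show ?case
  proof (simp, intro conjI ballI allI)
    show "g differentiable at x" if "x \<in> U" for x
      using d[OF that] by (auto simp: differentiable_def)
    show "Ck_on k U (\<lambda>x. frechet_derivative g (at x) v)" for v
      by (rule Suc.IH[of "\<lambda>x. frechet_derivative f (at x) v"]) (use Suc.prems(1) eq in auto)
  qed
qed

text \<open>Trades the chosen \<open>frechet_derivative\<close> for any explicit formula
  \<open>D\<close>; the closure properties below are inductions in which the differentiation rule
  supplies \<open>D\<close>.\<close>

lemma Ck_on_SucI:
  assumes "open U" "\<And>x. x \<in> U \<Longrightarrow> (f has_derivative D x) (at x)" "\<And>v. Ck_on k U (\<lambda>x. D x v)"
  shows "Ck_on (Suc k) U f"
proof (simp, intro conjI ballI allI)
  show "f differentiable at x" if "x \<in> U" for x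
    using assms(2)[OF that] by (auto simp: differentiable_def)
  show "Ck_on k U (\<lambda>x. frechet_derivative f (at x) v)" for v
    by (rule Ck_on_cong[OF assms(1) assms(3)[of v]]) (use frechet_derivative_at assms(2) in metis)
qed

lemma Ck_on_const: "open U \<Longrightarrow> Ck_on k U (\<lambda>x. c)"
proof (induction k arbitrary: c)
  case (Suc k)
  show ?case by (rule Ck_on_SucI[where D="\<lambda>x v. 0"]) (use Suc in auto)
qed auto

lemma Ck_on_linear:
  assumes "bounded_linear h" "open U" "Ck_on k U f"
  shows "Ck_on k U (\<lambda>x. h (f x))"
  using assms(3)
proof (induction k arbitrary: f)
  case 0
  then show ?case by (simp add: bounded_linear.continuous_on[OF assms(1)])
next
  case (Suc k)
  show ?case
    by (rule Ck_on_SucI[OF assms(2), where D="\<lambda>x v. h (frechet_derivative f (at x) v)"])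
      (use Suc in \<open>auto intro!: bounded_linear.has_derivative[OF assms(1)] Ck_on_SucD\<close>)
qed

lemma Ck_on_ident: "open U \<Longrightarrow> Ck_on k U (\<lambda>x. x)"
proof (cases k)
  case (Suc n)
  assume "open U"
  then show ?thesis unfolding Suc
    by (intro Ck_on_SucI[where D="\<lambda>x v. v"]) (auto intro: Ck_on_const)
qed auto

lemma Ck_on_add:
  assumes "open U" "Ck_on k U f" "Ck_on k U g"
  shows "Ck_on k U (\<lambda>x. f x + g x)"
  using assms(2,3)
proof (induction k arbitrary: f g)
  case 0
  then show ?case by (simp add: continuous_on_add)
next
  case (Suc k)
  show ?case
    by (rule Ck_on_SucI[OF assms(1), where
          D="\<lambda>x v. frechet_derivative f (at x) v + frechet_derivative g (at x) v"])
      (use Suc in \<open>auto intro!: has_derivative_add Ck_on_SucD\<close>)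
qed

text \<open>The product rule yields two terms of the same bilinear shape with one order of
  differentiability less, so the induction runs over all pairs \<open>f\<close>, \<open>g\<close>.
  Inner product, scaling and multiplication are instances.\<close>

lemma Ck_on_bilinear:
  assumes "bounded_bilinear h" "open U" "Ck_on k U f" "Ck_on k U g"
  shows "Ck_on k U (\<lambda>x. h (f x) (g x))"
  using assms(3,4)
proof (induction k arbitrary: f g)
  case 0
  then show ?case by (simp add: bounded_bilinear.continuous_on[OF assms(1)])
next
  case (Suc k)
  have "Ck_on k U (\<lambda>x. h (f x) (frechet_derivative g (at x) v) +
      h (frechet_derivative f (at x) v) (g x))" for v
    by (intro Ck_on_add assms(2) Suc.IH) (use Suc.prems Ck_on_lower in auto)
  then show ?case
    by (intro Ck_on_SucI[OF assms(2) bounded_bilinear.FDERIV[OF assms(1)]])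
      (use Suc.prems in \<open>auto intro!: Ck_on_SucD\<close>)
qed

text \<open>Differentiating a real power lowers the exponent by one, so the induction varies
  \<open>a\<close> and keeps \<open>f\<close> fixed. The exponents \<open>1/2\<close> and
  \<open>-1/2\<close> provide square roots and their reciprocals.\<close>

lemma Ck_on_powr:
  fixes f :: "'a::euclidean_space \<Rightarrow> real"
  assumes "open U" "\<And>x. x \<in> U \<Longrightarrow> f x > 0" "Ck_on k U f"
  shows "Ck_on k U (\<lambda>x. f x powr a)"
  using assms(3)
proof (induction k arbitrary: a)
  case 0
  then show ?case using assms(2) by (auto intro!: continuous_on_powr simp: less_le)
next
  case (Suc k)
  have "((\<lambda>x. f x powr a) has_derivative
      (\<lambda>v. (a * f x powr (a - 1)) * frechet_derivative f (at x) v)) (at x)" if "x \<in> U" for x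
    using has_derivative_compose[OF Ck_on_SucD[OF Suc.prems that]
        has_real_derivative_powr[OF assms(2)[OF that], unfolded has_field_derivative_def]] .
  moreover have "Ck_on k U (\<lambda>x. (a * f x powr (a - 1)) * frechet_derivative f (at x) v)" for v
    by (intro Ck_on_bilinear[OF bounded_bilinear_mult assms(1)] Ck_on_const assms(1) Suc.IH)
      (use Suc.prems Ck_on_lower in auto)
  ultimately show ?case by (intro Ck_on_SucI[OF assms(1)])
qed

section \<open>Smoothness on arbitrary sets through extensions to open neighbourhoods\<close>

lemma smooth_on_obtain:
  assumes "smooth_on A f"
  obtains U F where "open U" "A \<subseteq> U" "\<And>k. Ck_on k U F" "\<And>x. x \<in> A \<Longrightarrow> f x = F x"
  using assms unfolding smooth_on_def by blast

lemma smooth_onI: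
  "open U \<Longrightarrow> A \<subseteq> U \<Longrightarrow> (\<And>k. Ck_on k U F) \<Longrightarrow> (\<And>x. x \<in> A \<Longrightarrow> f x = F x) \<Longrightarrow> smooth_on A f"
  unfolding smooth_on_def by blast

lemma smooth_on_cong: "smooth_on A f \<Longrightarrow> (\<And>x. x \<in> A \<Longrightarrow> g x = f x) \<Longrightarrow> smooth_on A g"
  unfolding smooth_on_def by metis

lemma smooth_on_const: "smooth_on A (\<lambda>x. c)"
  by (rule smooth_onI[of UNIV]) (auto intro: Ck_on_const)

lemma smooth_on_ident: "smooth_on A (\<lambda>x. x)"
  by (rule smooth_onI[of UNIV]) (auto intro: Ck_on_ident)

lemma smooth_on_linear:
  assumes "bounded_linear h" "smooth_on A f"
  shows "smooth_on A (\<lambda>x. h (f x))"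
proof -
  obtain U F where U: "open U" "A \<subseteq> U" "\<And>k. Ck_on k U F" "\<And>x. x \<in> A \<Longrightarrow> f x = F x"
    using smooth_on_obtain[OF assms(2)] by metis
  show ?thesis
    by (rule smooth_onI[OF U(1,2) Ck_on_linear[OF assms(1) U(1,3)]]) (simp add: U(4))
qed

lemma smooth_on_bilinear:
  assumes "bounded_bilinear h" "smooth_on A f" "smooth_on A g"
  shows "smooth_on A (\<lambda>x. h (f x) (g x))"
proof -
  obtain U F where U: "open U" "A \<subseteq> U" "\<And>k. Ck_on k U F" "\<And>x. x \<in> A \<Longrightarrow> f x = F x"
    using smooth_on_obtain[OF assms(2)] by metis
  obtain V G where V: "open V" "A \<subseteq> V" "\<And>k. Ck_on k V G" "\<And>x. x \<in> A \<Longrightarrow> g x = G x"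
    using smooth_on_obtain[OF assms(3)] by metis
  show ?thesis
    by (rule smooth_onI[of "U \<inter> V" _ "\<lambda>x. h (F x) (G x)"])
      (use U V Ck_on_subset[OF U(3) Int_lower1] Ck_on_subset[OF V(3) Int_lower2] in
        \<open>auto intro!: Ck_on_bilinear[OF assms(1)]\<close>)
qed

lemma smooth_on_add:
  assumes "smooth_on A f" "smooth_on A g"
  shows "smooth_on A (\<lambda>x. f x + g x)"
proof -
  obtain U F where U: "open U" "A \<subseteq> U" "\<And>k. Ck_on k U F" "\<And>x. x \<in> A \<Longrightarrow> f x = F x"
    using smooth_on_obtain[OF assms(1)] by metis
  obtain V G where V: "open V" "A \<subseteq> V" "\<And>k. Ck_on k V G" "\<And>x. x \<in> A \<Longrightarrow> g x = G x"
    using smooth_on_obtain[OF assms(2)] by metis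
  show ?thesis
    by (rule smooth_onI[of "U \<inter> V" _ "\<lambda>x. F x + G x"])
      (use U V Ck_on_subset[OF U(3) Int_lower1] Ck_on_subset[OF V(3) Int_lower2] in
        \<open>auto intro!: Ck_on_add\<close>)
qed

lemma smooth_on_imp_continuous_on:
  assumes "smooth_on A f"
  shows "continuous_on A f"
proof -
  obtain U F where U: "open U" "A \<subseteq> U" "\<And>k. Ck_on k U F" "\<And>x. x \<in> A \<Longrightarrow> f x = F x"
    using smooth_on_obtain[OF assms] by metis
  have "continuous_on A F"
    using Ck_on_imp_continuous_on[OF U(3)[of 0]] U(2) continuous_on_subset by blast
  then show ?thesis using U(4) by (simp cong: continuous_on_cong)
qed

lemma smooth_on_powr:
  fixes f :: "'a::euclidean_space \<Rightarrow> real"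
  assumes "smooth_on A f" "\<And>x. x \<in> A \<Longrightarrow> f x > 0"
  shows "smooth_on A (\<lambda>x. f x powr a)"
proof -
  obtain U F where U: "open U" "A \<subseteq> U" "\<And>k. Ck_on k U F" "\<And>x. x \<in> A \<Longrightarrow> f x = F x"
    using smooth_on_obtain[OF assms(1)] by metis
  \<comment> \<open>Positivity is known only on \<open>A\<close>, so the neighbourhood is cut down
    to the open set where the extension is still positive.\<close>
  have "open (U \<inter> F -` {0<..})"
    using Ck_on_imp_continuous_on[OF U(3)[of 0]] U(1) continuous_on_open_vimage[OF U(1)]
    by (metis inf_commute open_greaterThan)
  then show ?thesis
    by (intro smooth_onI[of "U \<inter> F -` {0<..}" _ "\<lambda>x. F x powr a"])
      (use U assms(2) Ck_on_subset[OF U(3) Int_lower1] in \<open>auto intro!: Ck_on_powr\<close>)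
qed

lemma smooth_on_diff:
  assumes "smooth_on A f" "smooth_on A g"
  shows "smooth_on A (\<lambda>x. f x - g x)"
proof -
  have "smooth_on A (\<lambda>x. - g x)"
    by (rule smooth_on_linear[OF bounded_linear_minus[OF bounded_linear_ident] assms(2)])
  from smooth_on_add[OF assms(1) this] show ?thesis by simp
qed

lemma smooth_on_Pair:
  assumes "smooth_on A f" "smooth_on A g"
  shows "smooth_on A (\<lambda>x. (f x, g x))"
proof -
  have "bounded_linear (\<lambda>x. (x, 0))" "bounded_linear (\<lambda>x. (0, x))"
    by (auto intro!: bounded_linear_Pair bounded_linear_ident bounded_linear_zero)
  from smooth_on_add[OF smooth_on_linear[OF this(1) assms(1)] smooth_on_linear[OF this(2) assms(2)]]
  show ?thesis by simp
qed

lemma smooth_on_sum: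
  assumes "finite I" "\<And>i. i \<in> I \<Longrightarrow> smooth_on A (f i)"
  shows "smooth_on A (\<lambda>x. \<Sum>i\<in>I. f i x)"
  using assms
proof (induction I rule: finite_induct)
  case empty
  then show ?case by (simp add: smooth_on_const)
next
  case (insert i I)
  then show ?case using smooth_on_add[of A "f i" "\<lambda>x. \<Sum>i\<in>I. f i x"] by simp
qed

lemmas smooth_on_fst = smooth_on_linear[OF bounded_linear_fst]
lemmas smooth_on_snd = smooth_on_linear[OF bounded_linear_snd]
lemmas smooth_on_inner = smooth_on_bilinear[OF bounded_bilinear_inner]
lemmas smooth_on_scaleR = smooth_on_bilinear[OF bounded_bilinear_scaleR]
lemmas smooth_on_mult = smooth_on_bilinear[OF bounded_bilinear_mult]

lemmas smooth_on_intros = smooth_on_const smooth_on_ident smooth_on_fst smooth_on_snd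
  smooth_on_inner smooth_on_scaleR smooth_on_mult smooth_on_add smooth_on_diff smooth_on_Pair

section \<open>Tangent vectors and derivatives along submanifolds\<close>

lemma tangent_space_obtain:
  assumes "d \<in> tangent_space M p"
  obtains c where "c 0 = p" "(c has_vector_derivative d) (at 0)" "\<forall>\<^sub>F t in nhds (0::real). c t \<in> M"
proof -
  obtain e c where c: "e > 0" "\<forall>t\<in>{-e<..<e}. c t \<in> M" "c 0 = p"
      "(c has_vector_derivative d) (at (0::real))"
    using assms unfolding tangent_space_def by blast
  have "\<forall>\<^sub>F t in nhds 0. t \<in> {-e<..<e}"
    using c(1) by (intro eventually_nhds_in_open) auto
  then have "\<forall>\<^sub>F t in nhds 0. c t \<in> M" by eventually_elim (use c in auto)
  then show thesis using that c by blast
qed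

lemma tangent_spaceI:
  assumes "e > 0" "smooth_on {-e<..<e} c" "\<And>t. \<bar>t\<bar> < e \<Longrightarrow> c t \<in> M" "c 0 = p"
    "(c has_vector_derivative d) (at 0)"
  shows "d \<in> tangent_space M p"
  unfolding tangent_space_def mem_Collect_eq
  by (rule exI[of _ e], intro conjI exI[of _ c]) (use assms in \<open>auto simp: abs_less_iff\<close>)

text \<open>Composing with a curve in \<open>M\<close> of velocity \<open>d\<close> turns any
  derivative within \<open>M\<close> into a derivative in one real variable, and uniqueness of the
  latter fixes the value on \<open>d\<close>.\<close>

lemma tderiv_eq:
  assumes f: "(f has_derivative f') (at p within M)" and d: "d \<in> tangent_space M p"
  shows "tderiv M f p d = f' d"
proof -
  obtain c where c: "c 0 = p" "(c has_vector_derivative d) (at 0)" "\<forall>\<^sub>F t in nhds (0::real). c t \<in> M"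
    using tangent_space_obtain[OF d] by metis
  obtain T where T: "open T" "0 \<in> T" "\<And>t. t \<in> T \<Longrightarrow> c t \<in> M"
    using c(3) unfolding eventually_nhds by blast
  have *: "((f \<circ> c) has_derivative (\<lambda>t. L (t *\<^sub>R d))) (at 0)"
    if "(f has_derivative L) (at p within M)" for L
  proof -
    have "(c has_derivative (\<lambda>t. t *\<^sub>R d)) (at 0 within T)"
      using c(2) unfolding has_vector_derivative_def by (rule has_derivative_at_withinI)
    moreover have "(f has_derivative L) (at (c 0) within c ` T)"
      using that c(1) T(3) by (auto intro: has_derivative_subset)
    ultimately have "((f \<circ> c) has_derivative (L \<circ> (\<lambda>t. t *\<^sub>R d))) (at 0 within T)"
      by (rule diff_chain_within)
    then show ?thesis by (simp add: at_within_open[OF T(2,1)] o_def)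
  qed
  have "(f has_derivative frechet_derivative f (at p within M)) (at p within M)"
    using f frechet_derivative_works differentiable_def by blast
  from has_derivative_unique[OF *[OF this] *[OF f]] show ?thesis
    unfolding tderiv_def by (metis scaleR_one)
qed

lemma smooth_on_has_derivative:
  assumes "smooth_on M f" "p \<in> M"
  obtains f' where "(f has_derivative f') (at p within M)"
proof -
  obtain U F where U: "open U" "M \<subseteq> U" "\<And>k. Ck_on k U F" "\<And>x. x \<in> M \<Longrightarrow> f x = F x"
    using smooth_on_obtain[OF assms(1)] by metis
  have "(F has_derivative frechet_derivative F (at p)) (at p within M)"
    using Ck_on_SucD[OF U(3)] U(2) assms(2) has_derivative_at_withinI by blast
  then have "(f has_derivative frechet_derivative F (at p)) (at p within M)"
    using has_derivative_transform[of p M f F] U(4) assms(2) by blast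
  then show thesis by (rule that)
qed

text \<open>On tangent vectors the derivative of \<open>Y\<close> is that of a smooth extension
  \<open>F\<close>. Expanding \<open>X p\<close> in the standard basis leaves only directional
  derivatives of \<open>F\<close> in fixed directions, which are smooth by the recursive clause of
  \<open>Ck_on\<close>.\<close>

lemma smooth_on_tderiv:
  assumes X: "vector_field M X" and Y: "smooth_on M Y"
  shows "smooth_on M (\<lambda>p. tderiv M Y p (X p))"
proof -
  obtain U F where U: "open U" "M \<subseteq> U" "\<And>k. Ck_on k U F" "\<And>x. x \<in> M \<Longrightarrow> Y x = F x"
    using smooth_on_obtain[OF Y] by metis
  have Fd: "(F has_derivative frechet_derivative F (at p)) (at p)" if "p \<in> M" for p
    using Ck_on_SucD[OF U(3)] U(2) that by blast
  have "smooth_on M (\<lambda>p. frechet_derivative F (at p) i)" for i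
    by (rule smooth_onI[OF U(1,2)]) (use U(3)[of "Suc _"] in auto)
  then have "smooth_on M (\<lambda>p. \<Sum>i\<in>Basis. (X p \<bullet> i) *\<^sub>R frechet_derivative F (at p) i)"
    using X unfolding vector_field_def by (intro smooth_on_sum smooth_on_intros) auto
  then show ?thesis
  proof (rule smooth_on_cong)
    fix p assume p: "p \<in> M"
    have "(Y has_derivative frechet_derivative F (at p)) (at p within M)"
      using has_derivative_transform[OF p U(4) has_derivative_at_withinI[OF Fd[OF p]]] by blast
    then have "tderiv M Y p (X p) = frechet_derivative F (at p) (X p)"
      using X p unfolding vector_field_def by (intro tderiv_eq) auto
    also have "\<dots> = frechet_derivative F (at p) (\<Sum>i\<in>Basis. (X p \<bullet> i) *\<^sub>R i)"
      by (simp add: euclidean_representation)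
    also have "\<dots> = (\<Sum>i\<in>Basis. (X p \<bullet> i) *\<^sub>R frechet_derivative F (at p) i)"
      using has_derivative_linear[OF Fd[OF p]] by (simp add: linear_sum linear_cmul)
    finally show "tderiv M Y p (X p) = \<dots>" .
  qed
qed

text \<open>A function constant on \<open>M\<close> has derivative zero within \<open>M\<close>.
  This turns each equation satisfied on a manifold into a linear equation for its tangent
  vectors.\<close>

lemma tangent_space_constraint:
  assumes "d \<in> tangent_space M p" "(\<phi> has_derivative \<phi>') (at p)" "\<And>q. q \<in> M \<Longrightarrow> \<phi> q = k" "p \<in> M"
  shows "\<phi>' d = 0"
proof -
  have "(\<phi> has_derivative (\<lambda>_. 0)) (at p within M)"
    by (rule has_derivative_transform[OF assms(4), of _ "\<lambda>_. k"]) (use assms(3) in auto)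
  then show ?thesis
    using tderiv_eq[OF _ assms(1), of \<phi>] has_derivative_at_withinI[OF assms(2)] by metis
qed

section \<open>The unit sphere and its tangent bundle\<close>

lemma has_real_derivative_inner:
  assumes "(f has_vector_derivative f') (at x within A)" "(g has_vector_derivative g') (at x within A)"
  shows "((\<lambda>t. f t \<bullet> g t) has_real_derivative (f x \<bullet> g' + f' \<bullet> g x)) (at x within A)"
  using has_derivative_inner[OF assms[unfolded has_vector_derivative_def]]
  unfolding has_field_derivative_def
  by (rule has_derivative_eq_rhs) (auto simp: algebra_simps)

text \<open>The condition \<open>y 0 \<bullet> b = 0\<close> makes the squared length of
  \<open>y\<close> stationary at \<open>0\<close>, so dividing by the length does not change the
  velocity there. The reciprocal length is written as a real power to have its smoothness at
  hand.\<close>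

lemma normalised_curve:
  fixes y :: "real \<Rightarrow> 'a::euclidean_space"
  assumes y: "smooth_on A y" "\<And>t. y t \<noteq> 0" "norm (y 0) = 1" "(y has_vector_derivative b) (at 0)"
    "y 0 \<bullet> b = 0"
  defines "n \<equiv> \<lambda>t. ((y t \<bullet> y t) powr (-1/2)) *\<^sub>R y t"
  shows "smooth_on A n" "norm (n t) = 1" "n 0 = y 0" "(n has_vector_derivative b) (at 0)"
proof -
  have pos: "y t \<bullet> y t > 0" for t using y(2) by simp
  show "smooth_on A n"
    unfolding n_def by (intro smooth_on_intros smooth_on_powr y(1) pos)
  have "(y t \<bullet> y t) powr (-1/2) = inverse (norm (y t))"
    using pos[of t] by (simp add: powr_minus powr_half_sqrt norm_eq_sqrt_inner flip: minus_divide_left)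
  then show "norm (n t) = 1" unfolding n_def using y(2)[of t] by simp
  have y0: "y 0 \<bullet> y 0 = 1" using y(3) by (simp add: dot_square_norm)
  then show "n 0 = y 0" unfolding n_def by simp
  have "((\<lambda>t. y t \<bullet> y t) has_real_derivative 0) (at 0)"
    using has_real_derivative_inner[OF y(4) y(4)] y(5) by (simp add: inner_commute)
  from DERIV_chain2[OF has_real_derivative_powr[OF pos] this]
  have "((\<lambda>t. (y t \<bullet> y t) powr (-1/2)) has_real_derivative 0) (at 0)" by simp
  from has_vector_derivative_scaleR[OF this y(4)] y0
  show "(n has_vector_derivative b) (at 0)" unfolding n_def by simp
qed

lemma unit_curve:
  fixes x a :: "'a::euclidean_space"
  assumes "norm x = 1" "x \<bullet> a = 0"
  defines "\<gamma> \<equiv> \<lambda>t::real. (((x + t *\<^sub>R a) \<bullet> (x + t *\<^sub>R a)) powr (-1/2)) *\<^sub>R (x + t *\<^sub>R a)"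
  shows "smooth_on A \<gamma>" "norm (\<gamma> t) = 1" "\<gamma> 0 = x" "(\<gamma> has_vector_derivative a) (at 0)"
proof -
  have "(x + t *\<^sub>R a) \<bullet> (x + t *\<^sub>R a) = 1 + t\<^sup>2 * (a \<bullet> a)" for t
    using assms(2) norm_eq_1[of x] assms(1) by (simp add: inner_add inner_commute power2_eq_square)
  moreover have "1 + t\<^sup>2 * (a \<bullet> a) > 0" for t :: real
    by (smt (verit) inner_ge_zero mult_nonneg_nonneg zero_le_power2)
  ultimately have nz: "x + t *\<^sub>R a \<noteq> 0" for t by (metis inner_zero_left less_irrefl)
  have d: "((\<lambda>t. x + t *\<^sub>R a) has_vector_derivative a) (at 0)"
    by (auto intro!: derivative_eq_intros)
  have s: "smooth_on A (\<lambda>t. x + t *\<^sub>R a)" for A by (intro smooth_on_intros)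
  note * = normalised_curve[OF s nz _ d, folded \<gamma>_def]
  show "smooth_on A \<gamma>" "norm (\<gamma> t) = 1" "\<gamma> 0 = x" "(\<gamma> has_vector_derivative a) (at 0)"
    using * assms by simp_all
qed

lemma tangent_space_sphere:
  fixes x :: "'a::euclidean_space"
  assumes "norm x = 1"
  shows "d \<in> tangent_space (sphere 0 1) x \<longleftrightarrow> x \<bullet> d = 0"
proof
  assume d: "d \<in> tangent_space (sphere 0 1) x"
  have "((\<lambda>q. q \<bullet> q) has_derivative (\<lambda>d. x \<bullet> d + d \<bullet> x)) (at x)"
    by (intro derivative_intros)
  from tangent_space_constraint[OF d this, of 1] assms show "x \<bullet> d = 0"
    by (simp add: inner_commute dot_square_norm)
next
  assume "x \<bullet> d = 0"
  from unit_curve[OF assms this] show "d \<in> tangent_space (sphere 0 1) x"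
    by (intro tangent_spaceI[of 1]) auto
qed

lemma tangent_bundle_sphere:
  "(x, v) \<in> tangent_bundle (sphere 0 1) \<longleftrightarrow> norm x = 1 \<and> x \<bullet> v = 0"
  unfolding tangent_bundle_def using tangent_space_sphere by auto

lemma tangent_space_tangent_bundle_sphere:
  fixes x v :: "'a::euclidean_space"
  assumes "norm x = 1" "x \<bullet> v = 0"
  shows "(a, b) \<in> tangent_space (tangent_bundle (sphere 0 1)) (x, v) \<longleftrightarrow> x \<bullet> a = 0 \<and> a \<bullet> v + x \<bullet> b = 0"
proof
  let ?T = "tangent_bundle (sphere (0::'a) 1)"
  assume d: "(a, b) \<in> tangent_space ?T (x, v)"
  have m: "(x, v) \<in> ?T" using assms by (simp add: tangent_bundle_sphere)
  have "((\<lambda>q. fst q \<bullet> fst q) has_derivative (\<lambda>d. fst (x, v) \<bullet> fst d + fst d \<bullet> fst (x, v))) (at (x, v))"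
    by (intro derivative_intros)
  from tangent_space_constraint[OF d this, of 1] m have "x \<bullet> a = 0"
    by (auto simp: inner_commute dot_square_norm tangent_bundle_sphere)
  have "((\<lambda>q. fst q \<bullet> snd q) has_derivative (\<lambda>d. fst (x, v) \<bullet> snd d + fst d \<bullet> snd (x, v))) (at (x, v))"
    by (intro derivative_intros)
  from tangent_space_constraint[OF d this, of 0] m have "a \<bullet> v + x \<bullet> b = 0"
    by (auto simp: tangent_bundle_sphere)
  with \<open>x \<bullet> a = 0\<close> show "x \<bullet> a = 0 \<and> a \<bullet> v + x \<bullet> b = 0" by simp
next
  assume *: "x \<bullet> a = 0 \<and> a \<bullet> v + x \<bullet> b = 0"
  obtain \<gamma> where \<gamma>: "\<And>A. smooth_on A \<gamma>" "\<And>t. norm (\<gamma> t) = 1" "\<gamma> 0 = x"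
      "(\<gamma> has_vector_derivative a) (at (0::real))"
    using unit_curve[OF assms(1)] * by blast
  define w where "w t = v + t *\<^sub>R b" for t
  \<comment> \<open>Removing the component of \<open>w t\<close> along \<open>\<gamma> t\<close>
    keeps the curve in the tangent bundle; the equation
    \<open>a \<bullet> v + x \<bullet> b = 0\<close> says that this component has derivative zero at
    \<open>0\<close>, so the velocity remains \<open>b\<close>.\<close>
  define c where "c t = (\<gamma> t, w t - (w t \<bullet> \<gamma> t) *\<^sub>R \<gamma> t)" for t
  have dw: "(w has_vector_derivative b) (at 0)"
    unfolding w_def by (auto intro!: derivative_eq_intros)
  have "((\<lambda>t. w t \<bullet> \<gamma> t) has_real_derivative (v \<bullet> a + b \<bullet> x)) (at 0)"
    using has_real_derivative_inner[OF dw \<gamma>(4)] by (simp add: \<gamma>(3) w_def)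
  then have "((\<lambda>t. w t \<bullet> \<gamma> t) has_real_derivative 0) (at 0)"
    using * by (simp add: inner_commute)
  from has_vector_derivative_diff[OF dw has_vector_derivative_scaleR[OF this \<gamma>(4)]]
  have "((\<lambda>t. w t - (w t \<bullet> \<gamma> t) *\<^sub>R \<gamma> t) has_vector_derivative b) (at 0)"
    using assms(2) by (simp add: w_def \<gamma>(3) inner_commute)
  then have d: "(c has_vector_derivative (a, b)) (at 0)"
    unfolding c_def by (rule has_vector_derivative_Pair[OF \<gamma>(4)])
  have s: "smooth_on A c" for A
    unfolding c_def w_def by (intro smooth_on_intros \<gamma>(1))
  show "(a, b) \<in> tangent_space (tangent_bundle (sphere 0 1)) (x, v)"
  proof (rule tangent_spaceI[OF zero_less_one s _ _ d])
    show "c t \<in> tangent_bundle (sphere 0 1)" for t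
      using \<gamma>(2)[of t] unfolding c_def tangent_bundle_sphere
      by (simp add: inner_diff_right dot_square_norm inner_commute)
    show "c 0 = (x, v)" unfolding c_def w_def using \<gamma>(3) assms(2) by (simp add: inner_commute)
  qed
qed

section \<open>The Levi-Civita connection of the unit sphere\<close>

text \<open>The orthogonal projection of a constant vector. At a point where \<open>w\<close> is
  already tangent the field takes the value \<open>w\<close>, so every tangent vector extends to a
  global field.\<close>

lemma vector_field_sphere_proj: "vector_field (sphere 0 1) (\<lambda>q::'a::euclidean_space. w - (w \<bullet> q) *\<^sub>R q)"
  unfolding vector_field_def
  by (auto intro!: smooth_on_intros
      simp: tangent_space_sphere inner_diff_right dot_square_norm inner_commute)

lemma sphere_vector_field_orth: "vector_field (sphere 0 1) X \<Longrightarrow> norm x = 1 \<Longrightarrow> x \<bullet> X x = 0"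
  using tangent_space_sphere unfolding vector_field_def by (metis mem_sphere_0)

text \<open>Differentiating \<open>q \<bullet> Y q = 0\<close> along \<open>X\<close> shows that the
  normal component of the ambient derivative is \<open>- (X p \<bullet> Y p)\<close>; the added term
  cancels it.\<close>

definition sphere_connection :: "('a::euclidean_space \<Rightarrow> 'a) \<Rightarrow> ('a \<Rightarrow> 'a) \<Rightarrow> 'a \<Rightarrow> 'a" where
  "sphere_connection X Y p = tderiv (sphere 0 1) Y p (X p) + (X p \<bullet> Y p) *\<^sub>R p"

lemma vector_field_sphere_connection:
  fixes X Y :: "'a::euclidean_space \<Rightarrow> 'a"
  assumes "vector_field (sphere 0 1) X" "vector_field (sphere 0 1) Y"
  shows "vector_field (sphere 0 1) (sphere_connection X Y)"
  unfolding vector_field_def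
proof (intro conjI ballI)
  have s: "smooth_on (sphere 0 1) X" "smooth_on (sphere 0 1) Y"
    using assms unfolding vector_field_def by auto
  then show "smooth_on (sphere 0 1) (sphere_connection X Y)"
    unfolding sphere_connection_def using smooth_on_tderiv[OF assms(1)]
    by (intro smooth_on_intros) auto
  fix p :: 'a assume p: "p \<in> sphere 0 1"
  obtain Y' where Y': "(Y has_derivative Y') (at p within sphere 0 1)"
    using smooth_on_has_derivative[OF s(2) p] by metis
  have t: "X p \<in> tangent_space (sphere 0 1) p" using assms(1) p unfolding vector_field_def by blast
  have "((\<lambda>q. q \<bullet> Y q) has_derivative (\<lambda>d. p \<bullet> Y' d + d \<bullet> Y p)) (at p within sphere 0 1)"
    using has_derivative_inner[OF has_derivative_ident Y'] .
  from tderiv_eq[OF this t]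
  have 1: "tderiv (sphere 0 1) (\<lambda>q. q \<bullet> Y q) p (X p) = p \<bullet> Y' (X p) + X p \<bullet> Y p" .
  have "((\<lambda>q. q \<bullet> Y q) has_derivative (\<lambda>d. 0)) (at p within sphere 0 1)"
    by (rule has_derivative_transform[OF p, of _ "\<lambda>_. 0"])
      (use sphere_vector_field_orth[OF assms(2)] in auto)
  from tderiv_eq[OF this t] 1 have "p \<bullet> Y' (X p) + X p \<bullet> Y p = 0" by simp
  then show "sphere_connection X Y p \<in> tangent_space (sphere 0 1) p"
    using p unfolding sphere_connection_def tderiv_eq[OF Y' t]
    by (simp add: tangent_space_sphere inner_add_right dot_square_norm)
qed

text \<open>The correction term is symmetric in \<open>X\<close> and \<open>Y\<close>, so it cancels
  in the torsion, and it is normal, so it disappears when paired with a tangent field in the metric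
  identity.\<close>

lemma is_levi_civita_sphere_connection:
  "is_levi_civita (sphere (0::'a::euclidean_space) 1) (\<lambda>_. (\<bullet>)) sphere_connection"
proof -
  let ?S = "sphere (0::'a) 1"
  let ?V = "vector_field ?S"
  have D: "\<exists>D. (f has_derivative D) (at p within ?S) \<and> linear D \<and>
      (\<forall>d\<in>tangent_space ?S p. tderiv ?S f p d = D d)"
    if "smooth_on ?S f" "p \<in> ?S" for f :: "'a \<Rightarrow> 'b::real_normed_vector" and p
    using smooth_on_has_derivative[OF that] tderiv_eq has_derivative_linear by metis
  have vD: "smooth_on ?S X" if "?V X" for X using that unfolding vector_field_def by blast
  have tX: "X p \<in> tangent_space ?S p" if "?V X" "p \<in> ?S" for X p
    using that unfolding vector_field_def by blast
  have 1: "sphere_connection (\<lambda>q. f q *\<^sub>R X q + X' q) Y p =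
      f p *\<^sub>R sphere_connection X Y p + sphere_connection X' Y p"
    if v: "?V X" "?V X'" "?V Y" "smooth_on ?S f" "p \<in> ?S" for X X' Y f p
  proof -
    obtain D' where D': "linear D'" "\<And>d. d \<in> tangent_space ?S p \<Longrightarrow> tderiv ?S Y p d = D' d"
      using D[OF vD[OF v(3)] v(5)] by blast
    \<comment> \<open>\<open>tderiv\<close> agrees with the linear map \<open>D'\<close> only on
      tangent vectors, so the combination must be known to be tangent before linearity
      applies.\<close>
    have "f p *\<^sub>R X p + X' p \<in> tangent_space ?S p"
      using tX[OF v(1,5)] tX[OF v(2,5)] v(5) by (simp add: tangent_space_sphere inner_add_right)
    then show ?thesis unfolding sphere_connection_def
      using D'(2) tX[OF v(1,5)] tX[OF v(2,5)]
      by (simp add: linear_add[OF D'(1)] linear_cmul[OF D'(1)] algebra_simps inner_add_left)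
  qed
  have 2: "sphere_connection X (\<lambda>q. f q *\<^sub>R Y q + Z q) p =
      f p *\<^sub>R sphere_connection X Y p + tderiv ?S f p (X p) *\<^sub>R Y p + sphere_connection X Z p"
    if v: "?V X" "?V Y" "?V Z" "smooth_on ?S f" "p \<in> ?S" for X Y Z f p
  proof -
    obtain Y' where Y': "(Y has_derivative Y') (at p within ?S)" "tderiv ?S Y p (X p) = Y' (X p)"
      using D[OF vD[OF v(2)] v(5)] tX[OF v(1,5)] by blast
    obtain Z' where Z': "(Z has_derivative Z') (at p within ?S)" "tderiv ?S Z p (X p) = Z' (X p)"
      using D[OF vD[OF v(3)] v(5)] tX[OF v(1,5)] by blast
    obtain f' where f': "(f has_derivative f') (at p within ?S)" "tderiv ?S f p (X p) = f' (X p)"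
      using D[OF v(4,5)] tX[OF v(1,5)] by blast
    show ?thesis unfolding sphere_connection_def
        tderiv_eq[OF has_derivative_add[OF has_derivative_scaleR[OF f'(1) Y'(1)] Z'(1)] tX[OF v(1,5)]]
      by (simp add: Y' Z' f' algebra_simps inner_add_right)
  qed
  have 3: "tderiv ?S (\<lambda>q. Y q \<bullet> Z q) p (X p) = sphere_connection X Y p \<bullet> Z p + Y p \<bullet> sphere_connection X Z p"
    if v: "?V X" "?V Y" "?V Z" "p \<in> ?S" for X Y Z p
  proof -
    obtain Y' where Y': "(Y has_derivative Y') (at p within ?S)" "tderiv ?S Y p (X p) = Y' (X p)"
      using D[OF vD[OF v(2)] v(4)] tX[OF v(1,4)] by blast
    obtain Z' where Z': "(Z has_derivative Z') (at p within ?S)" "tderiv ?S Z p (X p) = Z' (X p)"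
      using D[OF vD[OF v(3)] v(4)] tX[OF v(1,4)] by blast
    have "p \<bullet> Y p = 0" "p \<bullet> Z p = 0" using sphere_vector_field_orth that by auto
    then show ?thesis unfolding sphere_connection_def
        tderiv_eq[OF has_derivative_inner[OF Y'(1) Z'(1)] tX[OF v(1,4)]]
      by (simp add: Y' Z' inner_add inner_commute)
  qed
  have "affine_connection ?S sphere_connection"
    unfolding affine_connection_def using vector_field_sphere_connection 1 2 by blast
  then show ?thesis
    unfolding is_levi_civita_def using 3
    by (simp add: sphere_connection_def lie_bracket_def inner_commute)
qed

text \<open>Equal torsion makes the difference \<open>D\<close> symmetric, and metric compatibility
  makes it skew when paired with a third field. This removes its tangential part; the normal part
  vanishes because both connections return tangent fields.\<close>

lemma levi_civita_sphere_unique: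
  fixes X Y :: "'a::euclidean_space \<Rightarrow> 'a"
  assumes LC: "is_levi_civita (sphere 0 1) (\<lambda>_. (\<bullet>)) nabla" "is_levi_civita (sphere 0 1) (\<lambda>_. (\<bullet>)) nabla'"
    and X: "vector_field (sphere 0 1) X" and Y: "vector_field (sphere 0 1) Y" and p: "norm p = 1"
  shows "nabla X Y p = nabla' X Y p"
proof -
  define D where "D X Y = nabla X Y p - nabla' X Y p" for X Y
  let ?V = "vector_field (sphere (0::'a) 1)"
  have pS: "p \<in> sphere 0 1" using p by simp
  have torsion: "n X Y p - n Y X p = lie_bracket (sphere 0 1) X Y p"
    if "is_levi_civita (sphere 0 1) (\<lambda>_. (\<bullet>)) n" "?V X" "?V Y" for n X Y
    using that pS unfolding is_levi_civita_def by blast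
  have metric: "tderiv (sphere 0 1) (\<lambda>q. Y q \<bullet> Z q) p (X p) = n X Y p \<bullet> Z p + Y p \<bullet> n X Z p"
    if "is_levi_civita (sphere 0 1) (\<lambda>_. (\<bullet>)) n" "?V X" "?V Y" "?V Z" for n X Y Z
    using that pS unfolding is_levi_civita_def by blast
  have sym: "D X Y = D Y X" if "?V X" "?V Y" for X Y
  proof -
    have "nabla X Y p - nabla Y X p = nabla' X Y p - nabla' Y X p"
      using torsion[OF LC(1) that] torsion[OF LC(2) that] by simp
    then show ?thesis unfolding D_def by (simp add: algebra_simps)
  qed
  have skew: "D X Y \<bullet> Z p = - (Y p \<bullet> D X Z)" if "?V X" "?V Y" "?V Z" for X Y Z
  proof -
    have "nabla X Y p \<bullet> Z p + Y p \<bullet> nabla X Z p = nabla' X Y p \<bullet> Z p + Y p \<bullet> nabla' X Z p"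
      using metric[OF LC(1) that] metric[OF LC(2) that] by simp
    then show ?thesis unfolding D_def by (simp add: algebra_simps inner_diff)
  qed
  \<comment> \<open>A trilinear form symmetric in one pair of arguments and skew in an overlapping pair vanishes.\<close>
  have zero: "D X Y \<bullet> Z p = 0" if "?V Z" for Z
    using skew[OF X Y that] skew[OF that X Y] skew[OF Y that X] sym[OF X Y] sym[OF X that] sym[OF Y that]
    by (simp add: inner_commute)
  have "p \<bullet> n X Y p = 0" if "is_levi_civita (sphere 0 1) (\<lambda>_. (\<bullet>)) n" for n
  proof -
    have "affine_connection (sphere 0 1) n"
      using that unfolding is_levi_civita_def by (rule conjunct1)
    then have "\<forall>X Y. ?V X \<and> ?V Y \<longrightarrow> ?V (n X Y)"
      unfolding affine_connection_def by (rule conjunct1)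
    with X Y sphere_vector_field_orth p show ?thesis by blast
  qed
  from this[OF LC(1)] this[OF LC(2)] have o: "p \<bullet> D X Y = 0"
    unfolding D_def by (simp add: inner_diff_right)
  \<comment> \<open>The projected constant field with vector \<open>D X Y\<close> has that same
    value at \<open>p\<close>, since \<open>D X Y\<close> is orthogonal to \<open>p\<close>; thus
    \<open>D X Y\<close> can be paired with itself.\<close>
  have "D X Y \<bullet> D X Y = 0"
    using zero[OF vector_field_sphere_proj[of "D X Y"]] o by (simp add: inner_commute)
  then show ?thesis unfolding D_def by simp
qed

text \<open>Existence ensures that the chosen \<open>levi_civita\<close> is a Levi-Civita connection
  at all, and uniqueness identifies it with the explicit one.\<close>

lemma levi_civita_sphere:
  fixes X Y :: "'a::euclidean_space \<Rightarrow> 'a"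
  assumes "vector_field (sphere 0 1) X" "vector_field (sphere 0 1) Y" "norm p = 1"
  shows "levi_civita (sphere 0 1) (\<lambda>_. (\<bullet>)) X Y p = sphere_connection X Y p"
  using levi_civita_sphere_unique[OF _ is_levi_civita_sphere_connection assms]
    someI[of "is_levi_civita (sphere 0 1) (\<lambda>_. (\<bullet>))", OF is_levi_civita_sphere_connection]
  unfolding levi_civita_def by blast

section \<open>The splitting and the metric on the tangent bundle\<close>

lemma S2_1: "S2 1 = sphere 0 1"
  unfolding S2_def by simp

lemma g_S2_inner: "g_S2 = (\<lambda>_. (\<bullet>))"
  unfolding g_S2_def by (intro ext) simp

lemma TS2_1_iff: "(x, v) \<in> TS2 1 \<longleftrightarrow> norm x = 1 \<and> x \<bullet> v = 0"
  unfolding TS2_def S2_1 by (rule tangent_bundle_sphere)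

lemma tangent_space_TS2_1:
  assumes "(x, v) \<in> TS2 1"
  shows "(a, b) \<in> tangent_space (TS2 1) (x, v) \<longleftrightarrow> x \<bullet> a = 0 \<and> a \<bullet> v + x \<bullet> b = 0"
  using tangent_space_tangent_bundle_sphere assms unfolding TS2_1_iff unfolding TS2_def S2_1 by blast

lemma horizontal_space_1:
  assumes "(x, v) \<in> TS2 1"
  shows "horizontal_space 1 (x, v) = {(a, - (a \<bullet> v) *\<^sub>R x) | a. x \<bullet> a = 0}"
proof (intro equalityI subsetI)
  have x: "norm x = 1" "x \<bullet> v = 0" using assms by (simp_all add: TS2_1_iff)
  fix \<xi>
  {
    assume "\<xi> \<in> horizontal_space 1 (x, v)"
    then obtain X Y where XY: "vector_field (sphere 0 1) X" "vector_field (sphere 0 1) Y" "Y x = v"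
        "levi_civita (sphere 0 1) (\<lambda>_. (\<bullet>)) X Y x = 0" "\<xi> = (X x, tderiv (sphere 0 1) Y x (X x))"
      unfolding horizontal_space_def S2_1 g_S2_inner by auto
    have "tderiv (sphere 0 1) Y x (X x) = - (X x \<bullet> v) *\<^sub>R x"
      using XY(4) levi_civita_sphere[OF XY(1,2) x(1)] XY(3)
      unfolding sphere_connection_def by (simp add: eq_neg_iff_add_eq_0)
    with XY(5) sphere_vector_field_orth[OF XY(1) x(1)]
    show "\<xi> \<in> {(a, - (a \<bullet> v) *\<^sub>R x) | a. x \<bullet> a = 0}" by auto
  next
    assume "\<xi> \<in> {(a, - (a \<bullet> v) *\<^sub>R x) | a. x \<bullet> a = 0}"
    then obtain a where a: "\<xi> = (a, - (a \<bullet> v) *\<^sub>R x)" "x \<bullet> a = 0" by auto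
    \<comment> \<open>The projected constant field through \<open>v\<close> is parallel at
      \<open>x\<close> in every tangent direction: its derivative there is purely normal. Together
      with the field through \<open>a\<close> it witnesses the whole claimed space.\<close>
    define X where "X w q = w - (w \<bullet> q) *\<^sub>R q" for w q :: R3
    have X: "vector_field (sphere 0 1) (X w)" for w
      unfolding X_def by (rule vector_field_sphere_proj)
    have Xx: "X w x = w" if "x \<bullet> w = 0" for w
      using that unfolding X_def by (simp add: inner_commute)
    have "(X v has_derivative (\<lambda>d. - ((v \<bullet> x) *\<^sub>R d + (v \<bullet> d) *\<^sub>R x))) (at x within sphere 0 1)"
      unfolding X_def by (auto intro!: derivative_eq_intros)
    moreover have "a \<in> tangent_space (sphere 0 1) x" using a(2) x(1) by (simp add: tangent_space_sphere)
    ultimately have "tderiv (sphere 0 1) (X v) x a = - ((v \<bullet> x) *\<^sub>R a + (v \<bullet> a) *\<^sub>R x)"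
      by (rule tderiv_eq)
    then have t: "tderiv (sphere 0 1) (X v) x a = - (a \<bullet> v) *\<^sub>R x"
      using x(2) by (simp add: inner_commute)
    have "levi_civita (sphere 0 1) (\<lambda>_. (\<bullet>)) (X a) (X v) x = 0"
      unfolding levi_civita_sphere[OF X X x(1)] sphere_connection_def Xx[OF a(2)] Xx[OF x(2)] t by simp
    then show "\<xi> \<in> horizontal_space 1 (x, v)"
      unfolding horizontal_space_def S2_1 g_S2_inner mem_Collect_eq fst_conv snd_conv
      using X Xx[OF a(2)] Xx[OF x(2)] a(1) t by (intro exI[of _ "X a"] exI[of _ "X v"]) simp
  }
qed

lemma hlift_1:
  assumes "(x, v) \<in> TS2 1" "x \<bullet> w = 0"
  shows "hlift 1 (x, v) w = (w, - (w \<bullet> v) *\<^sub>R x)"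
  unfolding hlift_def horizontal_space_1[OF assms(1)] using assms(2) by (intro the_equality) auto

text \<open>The first coordinate forces the horizontal part to be \<open>a\<close>, and subtracting
  its lift leaves the vertical part. The second tangency equation of the bundle is exactly
  orthogonality of that remainder to \<open>x\<close>.\<close>

lemma components_1:
  assumes u: "(x, v) \<in> TS2 1" and \<xi>: "(a, b) \<in> tangent_space (TS2 1) (x, v)"
  shows "components 1 (x, v) (a, b) = (a, b + (a \<bullet> v) *\<^sub>R x)"
proof -
  have x: "norm x = 1" using u by (simp add: TS2_1_iff)
  then have xx: "x \<bullet> x = 1" by (simp add: dot_square_norm)
  have ab: "x \<bullet> a = 0" "a \<bullet> v + x \<bullet> b = 0" using \<xi> tangent_space_TS2_1[OF u] by auto
  show ?thesis
    unfolding components_def S2_1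
  proof (rule the_equality, goal_cases)
    case 1
    show ?case using ab xx by (simp add: tangent_space_sphere[OF x] hlift_1[OF u] vlift_def inner_add_right)
  next
    case (2 wz)
    then show ?case
      using hlift_1[OF u] by (auto simp: tangent_space_sphere[OF x] vlift_def)
  qed
qed

lemma hcomp_1:
  "(x, v) \<in> TS2 1 \<Longrightarrow> (a, b) \<in> tangent_space (TS2 1) (x, v) \<Longrightarrow> hcomp 1 (x, v) (a, b) = a"
  unfolding hcomp_def by (simp add: components_1)

lemma vcomp_1:
  "(x, v) \<in> TS2 1 \<Longrightarrow> (a, b) \<in> tangent_space (TS2 1) (x, v) \<Longrightarrow>
    vcomp 1 (x, v) (a, b) = b + (a \<bullet> v) *\<^sub>R x"
  unfolding vcomp_def by (simp add: components_1)

lemma g_TS2_1_1: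
  assumes "(x, v) \<in> TS2 1" "(a, b) \<in> tangent_space (TS2 1) (x, v)" "(a', b') \<in> tangent_space (TS2 1) (x, v)"
  shows "g_TS2 1 1 (x, v) (a, b) (a', b') = sqrt (1 + v \<bullet> v) * (a \<bullet> a') +
    1 / sqrt (1 + v \<bullet> v) * ((b + (a \<bullet> v) *\<^sub>R x) \<bullet> (b' + (a' \<bullet> v) *\<^sub>R x))"
  unfolding g_TS2_def pi_pullback_hor_def pi_pullback_ver_def fibre_norm_def
  using assms by (simp add: hcomp_1 vcomp_1 g_S2_inner)

text \<open>Because \<open>1 + v \<bullet> v\<close> is positive even at \<open>v = 0\<close>, both
  weights remain smooth and positive across the zero section.\<close>

lemma riemannian_metric_g_TS2: "riemannian_metric (TS2 1) (g_TS2 1 1)"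
  unfolding riemannian_metric_def
proof (intro conjI ballI allI impI)
  fix p \<xi> \<eta> assume "p \<in> TS2 1" "\<xi> \<in> tangent_space (TS2 1) p" "\<eta> \<in> tangent_space (TS2 1) p"
  then show "g_TS2 1 1 p \<xi> \<eta> = g_TS2 1 1 p \<eta> \<xi>"
    by (cases p; cases \<xi>; cases \<eta>) (simp add: g_TS2_1_1 inner_commute)
next
  fix p \<xi> \<xi>' \<eta> and k :: real
  assume *: "p \<in> TS2 1" "\<xi> \<in> tangent_space (TS2 1) p" "\<xi>' \<in> tangent_space (TS2 1) p"
    "\<eta> \<in> tangent_space (TS2 1) p"
  obtain x v a b a' b' c d where e: "p = (x, v)" "\<xi> = (a, b)" "\<xi>' = (a', b')" "\<eta> = (c, d)"
    by (metis surj_pair)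
  have u: "(x, v) \<in> TS2 1" using * e by simp
  have t: "(a, b) \<in> tangent_space (TS2 1) (x, v)" "(a', b') \<in> tangent_space (TS2 1) (x, v)"
    "(c, d) \<in> tangent_space (TS2 1) (x, v)" using * e by auto
  have "k * (a \<bullet> v) + (a' \<bullet> v) + (k * (x \<bullet> b) + x \<bullet> b') =
      k * (a \<bullet> v + x \<bullet> b) + (a' \<bullet> v + x \<bullet> b')" by (simp add: algebra_simps)
  then have t': "(k *\<^sub>R a + a', k *\<^sub>R b + b') \<in> tangent_space (TS2 1) (x, v)"
    using t unfolding tangent_space_TS2_1[OF u] by (simp add: inner_add)
  show "g_TS2 1 1 p (k *\<^sub>R \<xi> + \<xi>') \<eta> = k * g_TS2 1 1 p \<xi> \<eta> + g_TS2 1 1 p \<xi>' \<eta>"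
    unfolding e using u t t' by (simp add: g_TS2_1_1 inner_add algebra_simps add_divide_distrib)
next
  fix p \<xi> assume *: "p \<in> TS2 1" "\<xi> \<in> tangent_space (TS2 1) p" "\<xi> \<noteq> 0"
  obtain x v a b where e: "p = (x, v)" "\<xi> = (a, b)" by (metis surj_pair)
  have pos: "sqrt (1 + v \<bullet> v) > 0" by (simp add: add_pos_nonneg)
  let ?z = "b + (a \<bullet> v) *\<^sub>R x"
  have "sqrt (1 + v \<bullet> v) * (a \<bullet> a) + 1 / sqrt (1 + v \<bullet> v) * (?z \<bullet> ?z) > 0"
  proof (cases "a = 0")
    case True
    with * e have "?z \<noteq> 0" by (auto simp: zero_prod_def)
    with True pos show ?thesis by simp
  next
    case False
    with pos show ?thesis by (intro add_pos_nonneg mult_pos_pos mult_nonneg_nonneg) auto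
  qed
  then show "0 < g_TS2 1 1 p \<xi> \<xi>" using * unfolding e by (simp add: g_TS2_1_1)
next
  fix X Y assume XY: "vector_field (TS2 1) X \<and> vector_field (TS2 1) Y"
  then have s: "smooth_on (TS2 1) X" "smooth_on (TS2 1) Y"
    unfolding vector_field_def by auto
  \<comment> \<open>A polynomial expression that agrees with \<open>vcomp\<close> on tangent
    vectors; the description operator in \<open>vcomp\<close> offers no smoothness of its
    own.\<close>
  define z where "z W p = snd (W p) + (fst (W p) \<bullet> snd p) *\<^sub>R fst p" for W :: "TR3 \<Rightarrow> TR3" and p
  have "smooth_on (TS2 1) (\<lambda>p. (1 + snd p \<bullet> snd p) powr (1/2) * (fst (X p) \<bullet> fst (Y p)) +
      (1 + snd p \<bullet> snd p) powr (-1/2) * (z X p \<bullet> z Y p))"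
    unfolding z_def
    by (intro smooth_on_intros smooth_on_powr s) (auto simp: add_pos_nonneg)
  then show "smooth_on (TS2 1) (\<lambda>p. g_TS2 1 1 p (X p) (Y p))"
  proof (rule smooth_on_cong)
    fix p assume p: "p \<in> TS2 1"
    then have t: "X p \<in> tangent_space (TS2 1) p" "Y p \<in> tangent_space (TS2 1) p"
      using XY unfolding vector_field_def by auto
    have "(1 + snd p \<bullet> snd p) powr (-1/2) = 1 / sqrt (1 + snd p \<bullet> snd p)"
      by (simp add: powr_minus powr_half_sqrt add_nonneg_nonneg inverse_eq_divide flip: minus_divide_left)
    moreover have "(1 + snd p \<bullet> snd p) powr (1/2) = sqrt (1 + snd p \<bullet> snd p)"
      by (simp add: powr_half_sqrt add_nonneg_nonneg)
    ultimately show "g_TS2 1 1 p (X p) (Y p) = (1 + snd p \<bullet> snd p) powr (1/2) * (fst (X p) \<bullet> fst (Y p)) +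
      (1 + snd p \<bullet> snd p) powr (-1/2) * (z X p \<bullet> z Y p)"
      using g_TS2_1_1[of "fst p" "snd p" "fst (X p)" "snd (X p)" "fst (Y p)" "snd (Y p)"] p t
      unfolding z_def by simp
  qed
qed

section \<open>Polar coordinates and the Stenzel form\<close>

lemma polar_domain_iff:
  "((x, e), \<tau>) \<in> polar_domain \<longleftrightarrow> norm x = 1 \<and> norm e = 1 \<and> x \<bullet> e = 0 \<and> \<tau> > 0"
  unfolding polar_domain_def unit_tangent_bundle_def fibre_norm_def
  by (auto simp: TS2_1_iff g_S2_inner norm_eq_sqrt_inner)

text \<open>The linearised equations of an orthonormal pair; the radial velocity is free. Conversely
  a curve of orthonormal pairs with velocity \<open>(a, b)\<close> is produced by Gram-Schmidt from
  \<open>x + t a\<close> and \<open>e + t b\<close>.\<close>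

lemma tangent_space_polar_domain:
  assumes p: "((x, e), \<tau>) \<in> polar_domain"
  shows "((a, b), s) \<in> tangent_space polar_domain ((x, e), \<tau>) \<longleftrightarrow>
    x \<bullet> a = 0 \<and> e \<bullet> b = 0 \<and> a \<bullet> e + x \<bullet> b = 0"
proof
  assume d: "((a, b), s) \<in> tangent_space polar_domain ((x, e), \<tau>)"
  have *: "norm x = 1" "norm e = 1" "x \<bullet> e = 0" using p by (auto simp: polar_domain_iff)
  have m: "fst (fst q) \<bullet> fst (fst q) = 1" "snd (fst q) \<bullet> snd (fst q) = 1" "fst (fst q) \<bullet> snd (fst q) = 0"
    if "q \<in> polar_domain" for q
    using that by (cases q; cases "fst q"; auto simp: polar_domain_iff dot_square_norm)+
  have "((\<lambda>q. fst (fst q) \<bullet> fst (fst q)) has_derivative (\<lambda>d. x \<bullet> fst (fst d) + fst (fst d) \<bullet> x)) (at ((x, e), \<tau>))"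
    by (auto intro!: derivative_eq_intros)
  from tangent_space_constraint[OF d this m(1) p] have 1: "x \<bullet> a = 0" by (simp add: inner_commute)
  have "((\<lambda>q. snd (fst q) \<bullet> snd (fst q)) has_derivative (\<lambda>d. e \<bullet> snd (fst d) + snd (fst d) \<bullet> e)) (at ((x, e), \<tau>))"
    by (auto intro!: derivative_eq_intros)
  from tangent_space_constraint[OF d this m(2) p] have 2: "e \<bullet> b = 0" by (simp add: inner_commute)
  have "((\<lambda>q. fst (fst q) \<bullet> snd (fst q)) has_derivative (\<lambda>d. x \<bullet> snd (fst d) + fst (fst d) \<bullet> e)) (at ((x, e), \<tau>))"
    by (auto intro!: derivative_eq_intros)
  from tangent_space_constraint[OF d this m(3) p] have "a \<bullet> e + x \<bullet> b = 0" by simp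
  with 1 2 show "x \<bullet> a = 0 \<and> e \<bullet> b = 0 \<and> a \<bullet> e + x \<bullet> b = 0" by simp
next
  assume ab: "x \<bullet> a = 0 \<and> e \<bullet> b = 0 \<and> a \<bullet> e + x \<bullet> b = 0"
  have *: "norm x = 1" "norm e = 1" "x \<bullet> e = 0" "\<tau> > 0" using p by (auto simp: polar_domain_iff)
  have xx: "x \<bullet> x = 1" "e \<bullet> e = 1" using * by (simp_all add: dot_square_norm)
  define X where "X t = x + t *\<^sub>R a" for t
  define E where "E t = e + t *\<^sub>R b" for t
  \<comment> \<open>the Gram-Schmidt projection of \<open>E t\<close> off \<open>X t\<close>, multiplied by \<open>X t \<bullet> X t\<close>\<close>
  define y where "y t = (1 + t * t * (a \<bullet> a)) *\<^sub>R E t - (t * t * (a \<bullet> b)) *\<^sub>R X t" for t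
  have XX: "X t \<bullet> X t = 1 + t * t * (a \<bullet> a)" for t
    using ab xx unfolding X_def by (simp add: inner_add inner_commute)
  have EE: "E t \<bullet> E t = 1 + t * t * (b \<bullet> b)" for t
    using ab xx unfolding E_def by (simp add: inner_add inner_commute)
  \<comment> \<open>The linear term in \<open>t\<close> is the mixed tangency equation, so the pair
    fails to be orthogonal only to second order and Gram-Schmidt preserves the velocity.\<close>
  have XE: "X t \<bullet> E t = t * t * (a \<bullet> b)" for t
  proof -
    have "X t \<bullet> E t = x \<bullet> e + t * (a \<bullet> e + x \<bullet> b) + t * t * (a \<bullet> b)"
      unfolding X_def E_def by (simp add: inner_add algebra_simps)
    then show ?thesis using ab * by simp
  qed
  have Xy: "X t \<bullet> y t = 0" for t
    unfolding y_def by (simp add: inner_diff_right XX XE)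
  \<comment> \<open>\<open>y t \<bullet> E t\<close> is the Gram determinant of \<open>X t\<close>
    and \<open>E t\<close>; by Cauchy-Schwarz for \<open>a\<close> and \<open>b\<close> it is at
    least \<open>1\<close>.\<close>
  have y_nz: "y t \<noteq> 0" for t
  proof -
    have "t * t * (a \<bullet> b) * (t * t * (a \<bullet> b)) = (t * t) * (t * t) * (a \<bullet> b)\<^sup>2"
      by (simp add: power2_eq_square)
    also have "\<dots> \<le> (t * t) * (t * t) * ((a \<bullet> a) * (b \<bullet> b))"
      by (intro mult_left_mono Cauchy_Schwarz_ineq) auto
    finally have "(1 + t * t * (a \<bullet> a)) * (1 + t * t * (b \<bullet> b)) - t * t * (a \<bullet> b) * (t * t * (a \<bullet> b)) \<ge>
        1 + t * t * (a \<bullet> a) + t * t * (b \<bullet> b)" by (simp add: algebra_simps)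
    moreover have "t * t * (a \<bullet> a) \<ge> 0" "t * t * (b \<bullet> b) \<ge> 0" by simp_all
    moreover have "y t \<bullet> E t = (1 + t * t * (a \<bullet> a)) * (1 + t * t * (b \<bullet> b)) -
        t * t * (a \<bullet> b) * (t * t * (a \<bullet> b))"
      unfolding y_def by (simp add: inner_diff_left EE XE)
    ultimately have "y t \<bullet> E t > 0" by linarith
    then show ?thesis by auto
  qed
  have y0: "y 0 = e" unfolding y_def E_def by simp
  have dy: "(y has_vector_derivative b) (at 0)"
    unfolding y_def X_def E_def by (auto intro!: derivative_eq_intros)
  have sy: "smooth_on A y" for A
    unfolding y_def X_def E_def by (intro smooth_on_intros)
  define n where "n t = ((y t \<bullet> y t) powr (-1/2)) *\<^sub>R y t" for t
  have n: "smooth_on A n" "norm (n t) = 1" "n 0 = e" "(n has_vector_derivative b) (at 0)" for A t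
    using normalised_curve[OF sy y_nz _ dy] * ab y0 unfolding n_def by auto
  define g where "g t = ((X t \<bullet> X t) powr (-1/2)) *\<^sub>R X t" for t
  have g: "smooth_on A g" "norm (g t) = 1" "g 0 = x" "(g has_vector_derivative a) (at 0)" for A t
    using unit_curve[OF *(1), of a] ab unfolding g_def X_def by auto
  define c where "c t = ((g t, n t), \<tau> + t * s)" for t
  have "((\<lambda>t. \<tau> + t * s) has_vector_derivative s) (at 0)"
    by (auto intro!: derivative_eq_intros)
  then have dc: "(c has_vector_derivative ((a, b), s)) (at 0)"
    unfolding c_def by (intro has_vector_derivative_Pair g(4) n(4))
  have sc: "smooth_on A c" for A
    unfolding c_def by (intro smooth_on_intros g(1) n(1))
  \<comment> \<open>On this interval \<open>\<tau> + t * s\<close> stays positive; the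
    \<open>+ 1\<close> covers \<open>s = 0\<close>.\<close>
  have eps: "\<tau> / (\<bar>s\<bar> + 1) > 0" using *(4) by (simp add: add_nonneg_pos)
  show "((a, b), s) \<in> tangent_space polar_domain ((x, e), \<tau>)"
  proof (rule tangent_spaceI[OF eps sc _ _ dc])
    show "c 0 = ((x, e), \<tau>)" unfolding c_def using g(3) n(3) by simp
    fix t assume "\<bar>t\<bar> < \<tau> / (\<bar>s\<bar> + 1)"
    then have "\<bar>t\<bar> * (\<bar>s\<bar> + 1) < \<tau>" by (simp add: pos_less_divide_eq add_nonneg_pos)
    then have "\<bar>t * s\<bar> < \<tau>" by (simp add: abs_mult algebra_simps)
    then have "\<tau> + t * s > 0" by linarith
    moreover have "g t \<bullet> n t = 0" unfolding g_def n_def using Xy by simp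
    ultimately show "c t \<in> polar_domain"
      unfolding c_def polar_domain_iff using g(2) n(2) by simp
  qed
qed

lemma tderiv_polar:
  assumes "((a, b), s) \<in> tangent_space polar_domain ((x, e), \<tau>)"
  shows "tderiv polar_domain polar ((x, e), \<tau>) ((a, b), s) = (a, sinh \<tau> *\<^sub>R b + (cosh \<tau> * s) *\<^sub>R e)"
proof -
  let ?F = "at ((x, e), \<tau>) within polar_domain"
  have "(sinh has_real_derivative cosh \<tau>) (at \<tau>)"
    using has_field_derivative_sinh[OF DERIV_ident] by simp
  then have "((\<lambda>q. sinh (snd q)) has_derivative (\<lambda>d. cosh \<tau> * snd d)) ?F"
    using has_derivative_compose[OF has_derivative_snd[OF has_derivative_ident],
        of sinh "\<lambda>d. cosh \<tau> * d" "((x, e), \<tau>)" polar_domain]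
    by (simp add: has_field_derivative_def)
  moreover have "((\<lambda>q. snd (fst q)) has_derivative (\<lambda>d. snd (fst d))) ?F"
    by (intro derivative_intros)
  ultimately have "((\<lambda>q. sinh (snd q) *\<^sub>R snd (fst q)) has_derivative
      (\<lambda>d. sinh \<tau> *\<^sub>R snd (fst d) + (cosh \<tau> * snd d) *\<^sub>R e)) ?F"
    by (rule has_derivative_eq_rhs[OF has_derivative_scaleR]) simp
  then have "(polar has_derivative (\<lambda>d. (fst (fst d), sinh \<tau> *\<^sub>R snd (fst d) + (cosh \<tau> * snd d) *\<^sub>R e))) ?F"
    unfolding polar_def by (intro has_derivative_Pair derivative_intros)
  from tderiv_eq[OF this assms] show ?thesis by simp
qed

text \<open>The vectors \<open>e\<close> and \<open>perp (x, e)\<close> form an orthonormal basis of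
  the plane orthogonal to \<open>x\<close>. The remainder \<open>r\<close> of the expansion of
  \<open>a\<close> is orthogonal to \<open>x\<close> and \<open>e\<close>, so Lagrange's formula
  gives \<open>cross3 r n = 0\<close>; as \<open>r\<close> is also orthogonal to the unit vector
  \<open>n\<close>, it vanishes.\<close>

lemma inner_perp_frame:
  assumes "norm x = 1" "norm e = 1" "x \<bullet> e = 0" "x \<bullet> a = 0" "x \<bullet> a' = 0"
  shows "a \<bullet> a' = (a \<bullet> e) * (a' \<bullet> e) + (a \<bullet> perp (x, e)) * (a' \<bullet> perp (x, e))"
proof -
  define n where "n = cross3 x e"
  define r where "r = a - (a \<bullet> e) *\<^sub>R e - (a \<bullet> n) *\<^sub>R n"
  have "(norm n)\<^sup>2 = 1"
    using norm_cross_dot[of x e] assms(1-3) unfolding n_def by simp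
  then have nn: "n \<bullet> n = 1" by (simp add: dot_square_norm)
  have n: "n \<bullet> x = 0" "n \<bullet> e = 0"
    unfolding n_def by (simp_all add: dot_cross_self)
  have ee: "e \<bullet> e = 1" using assms(2) by (simp add: dot_square_norm)
  have r: "r \<bullet> x = 0" "r \<bullet> e = 0" "r \<bullet> n = 0"
    unfolding r_def using assms(3,4) n nn ee inner_commute[of a x] inner_commute[of e x] inner_commute[of e n]
    by (simp_all add: inner_diff_left)
  have "cross3 r n = 0" unfolding n_def Lagrange using r by simp
  with r(3) nn have "r = 0" by (metis norm_and_cross_eq_0 inner_zero_left zero_neq_one)
  then have "a = (a \<bullet> e) *\<^sub>R e + (a \<bullet> n) *\<^sub>R n" unfolding r_def by (simp add: algebra_simps)
  then have "a \<bullet> a' = ((a \<bullet> e) *\<^sub>R e + (a \<bullet> n) *\<^sub>R n) \<bullet> a'" by simp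
  then show ?thesis
    unfolding perp_def fst_conv snd_conv n_def[symmetric]
    by (simp add: inner_add_left inner_commute[of e a'] inner_commute[of n a'])
qed

text \<open>At \<open>v = sinh \<tau> e\<close> the vertical component is an angular part with
  factor \<open>sinh \<tau>\<close> plus an orthogonal radial part with factor
  \<open>cosh \<tau>\<close>. Squaring these factors and dividing by \<open>cosh \<tau>\<close>
  gives the coefficients \<open>sinh \<tau> * tanh \<tau>\<close> and
  \<open>cosh \<tau>\<close>.\<close>

lemma polar_pullback_g_TS2:
  assumes p: "p \<in> polar_domain" and \<zeta>: "\<zeta> \<in> tangent_space polar_domain p"
    and \<eta>: "\<eta> \<in> tangent_space polar_domain p"
  shows "g_TS2 1 1 (polar p) (tderiv polar_domain polar p \<zeta>) (tderiv polar_domain polar p \<eta>) =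
    stenzel_form p \<zeta> \<eta>"
proof -
  obtain x e \<tau> a b s a' b' s' where eqs: "p = ((x, e), \<tau>)" "\<zeta> = ((a, b), s)" "\<eta> = ((a', b'), s')"
    by (metis surj_pair)
  have pd: "((x, e), \<tau>) \<in> polar_domain" using p eqs by simp
  have *: "norm x = 1" "norm e = 1" "x \<bullet> e = 0" "\<tau> > 0" using pd by (auto simp: polar_domain_iff)
  then have ee: "x \<bullet> x = 1" "e \<bullet> e = 1" by (simp_all add: dot_square_norm)
  have z: "x \<bullet> a = 0" "e \<bullet> b = 0" "a \<bullet> e + x \<bullet> b = 0" "x \<bullet> a' = 0" "e \<bullet> b' = 0" "a' \<bullet> e + x \<bullet> b' = 0"
    using \<zeta> \<eta> tangent_space_polar_domain[OF pd] unfolding eqs by auto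
  let ?S = "sinh \<tau>" and ?C = "cosh \<tau>"
  have u1: "(x, e) \<in> TS2 1" and u2: "(x, ?S *\<^sub>R e) \<in> TS2 1" using * by (simp_all add: TS2_1_iff)
  have t1: "(a, b) \<in> tangent_space (TS2 1) (x, e)" "(a', b') \<in> tangent_space (TS2 1) (x, e)"
    using z by (simp_all add: tangent_space_TS2_1[OF u1])
  have "?S * (a \<bullet> e) + ?S * (x \<bullet> b) = 0" "?S * (a' \<bullet> e) + ?S * (x \<bullet> b') = 0"
    using z by (simp_all flip: distrib_left)
  then have t2: "(a, ?S *\<^sub>R b + (?C * s) *\<^sub>R e) \<in> tangent_space (TS2 1) (x, ?S *\<^sub>R e)"
      "(a', ?S *\<^sub>R b' + (?C * s') *\<^sub>R e) \<in> tangent_space (TS2 1) (x, ?S *\<^sub>R e)"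
    using z * by (simp_all add: tangent_space_TS2_1[OF u2] inner_add_right)
  \<comment> \<open>The vertical component at the unit vector \<open>e\<close>. It is orthogonal to
    both \<open>x\<close> and \<open>e\<close>, so its only coordinate is the one measured by
    \<open>alpha2\<close>.\<close>
  define \<beta> where "\<beta> = b + (a \<bullet> e) *\<^sub>R x"
  define \<beta>' where "\<beta>' = b' + (a' \<bullet> e) *\<^sub>R x"
  have \<beta>: "x \<bullet> \<beta> = 0" "\<beta> \<bullet> e = 0" "x \<bullet> \<beta>' = 0" "\<beta>' \<bullet> e = 0"
    using z * ee unfolding \<beta>_def \<beta>'_def
    by (simp_all add: inner_add inner_commute add.commute)
  let ?n = "perp (x, e)"
  have \<beta>\<beta>: "\<beta> \<bullet> \<beta>' = (\<beta> \<bullet> ?n) * (\<beta>' \<bullet> ?n)"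
    using inner_perp_frame[OF *(1-3) \<beta>(1,3)] \<beta> by simp
  have aa: "a \<bullet> a' = (a \<bullet> e) * (a' \<bullet> e) + (a \<bullet> ?n) * (a' \<bullet> ?n)"
    by (rule inner_perp_frame[OF *(1-3) z(1,4)])
  have v: "?S *\<^sub>R b + (?C * s) *\<^sub>R e + (a \<bullet> (?S *\<^sub>R e)) *\<^sub>R x = ?S *\<^sub>R \<beta> + (?C * s) *\<^sub>R e"
    "?S *\<^sub>R b' + (?C * s') *\<^sub>R e + (a' \<bullet> (?S *\<^sub>R e)) *\<^sub>R x = ?S *\<^sub>R \<beta>' + (?C * s') *\<^sub>R e"
    unfolding \<beta>_def \<beta>'_def by (simp_all add: algebra_simps)
  have sq: "sqrt (1 + (?S *\<^sub>R e) \<bullet> (?S *\<^sub>R e)) = ?C"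
    using ee(2) cosh_square_eq[of \<tau>] by (simp add: power2_eq_square real_sqrt_unique)
  have "(?S *\<^sub>R \<beta> + (?C * s) *\<^sub>R e) \<bullet> (?S *\<^sub>R \<beta>' + (?C * s') *\<^sub>R e) =
      ?S * ?S * ((\<beta> \<bullet> ?n) * (\<beta>' \<bullet> ?n)) + ?C * ?C * (s * s')"
    using \<beta> ee(2) by (simp add: inner_add inner_commute[of e \<beta>'] \<beta>\<beta>)
  then have "g_TS2 1 1 (x, ?S *\<^sub>R e) (a, ?S *\<^sub>R b + (?C * s) *\<^sub>R e) (a', ?S *\<^sub>R b' + (?C * s') *\<^sub>R e) =
      ?C * (a \<bullet> a') + 1 / ?C * (?S * ?S * ((\<beta> \<bullet> ?n) * (\<beta>' \<bullet> ?n)) + ?C * ?C * (s * s'))"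
    unfolding g_TS2_1_1[OF u2 t2] sq v by simp
  also have "\<dots> = stenzel_form p \<zeta> \<eta>"
    unfolding stenzel_form_def alpha0_def alpha1_def alpha2_def Let_def eqs g_S2_inner aa tanh_def
    using hcomp_1[OF u1] vcomp_1[OF u1] t1
    by (simp add: \<beta>_def \<beta>'_def field_simps)
  finally show ?thesis
    using \<zeta> \<eta> unfolding eqs by (simp add: tderiv_polar polar_def)
qed

section \<open>Uniqueness of the Stenzel metric\<close>

lemma polar_surj:
  assumes u: "(x, v) \<in> TS2 1" and v: "v \<noteq> 0"
  obtains p where "p \<in> polar_domain" "polar p = (x, v)"
    "\<And>\<xi>. \<xi> \<in> tangent_space (TS2 1) (x, v) \<Longrightarrow>
      \<exists>\<zeta>\<in>tangent_space polar_domain p. tderiv polar_domain polar p \<zeta> = \<xi>"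
proof -
  define \<tau> where "\<tau> = arsinh (norm v)"
  define e where "e = v /\<^sub>R norm v"
  have S: "sinh \<tau> = norm v" unfolding \<tau>_def by (rule sinh_arsinh_real)
  have \<tau>: "\<tau> > 0" using v S by (metis sinh_real_pos_iff zero_less_norm_iff)
  have x: "norm x = 1" "x \<bullet> v = 0" using u by (auto simp: TS2_1_iff)
  have e: "norm e = 1" "x \<bullet> e = 0" "v = norm v *\<^sub>R e" using v x unfolding e_def by auto
  have p: "((x, e), \<tau>) \<in> polar_domain" using x e \<tau> by (simp add: polar_domain_iff)
  show thesis
  proof (rule that[OF p])
    show "polar ((x, e), \<tau>) = (x, v)" unfolding polar_def using S e(3) by simp
    fix \<xi> assume \<xi>: "\<xi> \<in> tangent_space (TS2 1) (x, v)"
    obtain a b where ab: "\<xi> = (a, b)" by (cases \<xi>)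
    have c: "x \<bullet> a = 0" "a \<bullet> v + x \<bullet> b = 0" using \<xi> tangent_space_TS2_1[OF u] unfolding ab by auto
    \<comment> \<open>Solves
      \<open>sinh \<tau> *\<^sub>R b' + (cosh \<tau> * s) *\<^sub>R e = b\<close> by splitting
      \<open>b\<close> into its component along \<open>e\<close> and the rest.\<close>
    define b' where "b' = (b - (b \<bullet> e) *\<^sub>R e) /\<^sub>R norm v"
    define s where "s = (b \<bullet> e) / cosh \<tau>"
    have ee: "e \<bullet> e = 1" using e(1) by (simp add: dot_square_norm)
    have "e \<bullet> b' = 0" unfolding b'_def by (simp add: inner_diff_right ee inner_commute)
    moreover have "a \<bullet> e + x \<bullet> b' = (a \<bullet> v + x \<bullet> b) / norm v"
      unfolding b'_def using x(2) by (simp add: e_def inner_diff_right field_simps add_divide_distrib)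
    ultimately have t: "((a, b'), s) \<in> tangent_space polar_domain ((x, e), \<tau>)"
      using c by (simp add: tangent_space_polar_domain[OF p])
    moreover have "tderiv polar_domain polar ((x, e), \<tau>) ((a, b'), s) = \<xi>"
      unfolding tderiv_polar[OF t] ab S using v by (simp add: b'_def s_def)
    ultimately show "\<exists>\<zeta>\<in>tangent_space polar_domain ((x, e), \<tau>).
        tderiv polar_domain polar ((x, e), \<tau>) \<zeta> = \<xi>" by blast
  qed
qed

text \<open>\<open>A\<close> is the projection of \<open>a\<close> off the base point, and the
  normal coefficient in \<open>B\<close> is chosen so that the tangency equations of the bundle hold
  at every point. At \<open>u\<close> both corrections vanish.\<close>

lemma tangent_vector_extension:
  assumes u: "u \<in> TS2 1" and \<xi>: "\<xi> \<in> tangent_space (TS2 1) u"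
  obtains X where "vector_field (TS2 1) X" "X u = \<xi>"
proof -
  obtain x v a b where eqs: "u = (x, v)" "\<xi> = (a, b)" by (metis surj_pair)
  have c: "x \<bullet> a = 0" "a \<bullet> v + x \<bullet> b = 0" using \<xi> u tangent_space_TS2_1 unfolding eqs by auto
  define A where "A q = a - (a \<bullet> fst q) *\<^sub>R fst q" for q :: TR3
  define B where "B q = b - (b \<bullet> fst q + A q \<bullet> snd q) *\<^sub>R fst q" for q :: TR3
  have sA: "smooth_on M A" for M unfolding A_def by (intro smooth_on_intros)
  have sB: "smooth_on M B" for M unfolding B_def by (intro smooth_on_intros sA)
  have "(A q, B q) \<in> tangent_space (TS2 1) q" if "q \<in> TS2 1" for q
  proof -
    obtain y w where q: "q = (y, w)" by (cases q)
    have yw: "(y, w) \<in> TS2 1" using that q by simp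
    then have "y \<bullet> y = 1" by (simp add: TS2_1_iff dot_square_norm)
    then show ?thesis
      unfolding q tangent_space_TS2_1[OF yw] B_def
      by (simp add: inner_diff_right inner_commute A_def)
  qed
  then have "vector_field (TS2 1) (\<lambda>q. (A q, B q))"
    unfolding vector_field_def by (auto intro: smooth_on_Pair sA sB)
  moreover have "A u = a" "B u = b"
    using c by (simp_all add: A_def B_def eqs inner_commute add.commute)
  ultimately show thesis using that eqs(2) by metis
qed

lemma stenzel_metric_unique:
  assumes s: "is_stenzel_metric s" and s': "is_stenzel_metric s'" and u: "u \<in> TS2 1"
    and \<xi>: "\<xi> \<in> tangent_space (TS2 1) u" and \<eta>: "\<eta> \<in> tangent_space (TS2 1) u"
  shows "s u \<xi> \<eta> = s' u \<xi> \<eta>"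
proof -
  have off_zero: "s u \<xi> \<eta> = s' u \<xi> \<eta>"
    if off: "snd u \<noteq> 0" "u \<in> TS2 1" "\<xi> \<in> tangent_space (TS2 1) u" "\<eta> \<in> tangent_space (TS2 1) u" for u \<xi> \<eta>
  proof -
    obtain p where p: "p \<in> polar_domain" "polar p = u" "\<And>\<xi>. \<xi> \<in> tangent_space (TS2 1) u \<Longrightarrow>
        \<exists>\<zeta>\<in>tangent_space polar_domain p. tderiv polar_domain polar p \<zeta> = \<xi>"
      using polar_surj[of "fst u" "snd u", unfolded prod.collapse, OF off(2,1)] by metis
    obtain \<zeta> \<zeta>' where "\<zeta> \<in> tangent_space polar_domain p" "tderiv polar_domain polar p \<zeta> = \<xi>"
        "\<zeta>' \<in> tangent_space polar_domain p" "tderiv polar_domain polar p \<zeta>' = \<eta>"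
      using p(3)[OF off(3)] p(3)[OF off(4)] by blast
    then show ?thesis using s s' p unfolding is_stenzel_metric_def by metis
  qed
  show ?thesis
  proof (cases "snd u = 0")
    case False
    then show ?thesis using off_zero u \<xi> \<eta> by blast
  next
    case True
    obtain x where x: "u = (x, 0)" using True by (cases u) auto
    obtain X where X: "vector_field (TS2 1) X" "X u = \<xi>" using tangent_vector_extension[OF u \<xi>] .
    obtain Y where Y: "vector_field (TS2 1) Y" "Y u = \<eta>" using tangent_vector_extension[OF u \<eta>] .
    \<comment> \<open>With the two vectors extended to fields, the difference of the metrics becomes
      a smooth function that vanishes off the zero section.\<close>
    define h where "h q = s q (X q) (Y q) - s' q (X q) (Y q)" for q
    have "smooth_on (TS2 1) h"
      unfolding h_def using s s' X Y unfolding is_stenzel_metric_def riemannian_metric_def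
      by (intro smooth_on_diff) blast+
    then have ch: "continuous_on (TS2 1) h" by (rule smooth_on_imp_continuous_on)
    have h0: "h q = 0" if "q \<in> TS2 1" "snd q \<noteq> 0" for q
      unfolding h_def using off_zero[OF that(2,1)] X(1) Y(1) that(1) unfolding vector_field_def by simp
    obtain e where e: "e \<noteq> 0" "x \<bullet> e = 0"
      using orthogonal_to_vector_exists[of x] by (auto simp: orthogonal_def)
    \<comment> \<open>A sequence in the fibre over \<open>x\<close> that avoids the zero section and
      converges to \<open>u\<close>.\<close>
    define w where "w n = (x, inverse (real (Suc n)) *\<^sub>R e)" for n
    have w: "w n \<in> TS2 1" "snd (w n) \<noteq> 0" for n
      using u e unfolding w_def x by (auto simp: TS2_1_iff)
    have "w \<longlonglongrightarrow> (x, 0 *\<^sub>R e)"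
      unfolding w_def by (intro tendsto_intros LIMSEQ_inverse_real_of_nat)
    then have "(h \<circ> w) \<longlonglongrightarrow> h u"
      using ch u w(1) unfolding continuous_on_sequentially x by simp
    moreover have "h \<circ> w = (\<lambda>n. 0)" using h0[OF w] by (simp add: o_def)
    ultimately have "h u = 0" using LIMSEQ_unique tendsto_const by metis
    then show ?thesis unfolding h_def X(2) Y(2) by simp
  qed
qed

theorem theorem4p5:
  shows "is_stenzel_metric (g_TS2 1 1) \<and>
    (\<forall>s. is_stenzel_metric s \<longrightarrow>
      (\<forall>u\<in>TS2 1. \<forall>\<xi>\<in>tangent_space (TS2 1) u. \<forall>\<eta>\<in>tangent_space (TS2 1) u.
        g_TS2 1 1 u \<xi> \<eta> = s u \<xi> \<eta>))"
proof -
  have "is_stenzel_metric (g_TS2 1 1)"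
    unfolding is_stenzel_metric_def using riemannian_metric_g_TS2 polar_pullback_g_TS2 by blast
  with stenzel_metric_unique show ?thesis by blast
qed

end
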